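(* Let $\mathcal{G}$ be a finite directed graph with condensation graph $\mathcal{C}(\mathcal{G})$, let $\mathcal{N}^e,\mathcal{N}^m\subseteq\mathcal{N}$ be the sets of excited and measured nodes, and let $\mathcal{F}_Z=\{f:\mathbb{R}\to\mathbb{R}\mid f \text{ analytic on } \mathbb{R},\ f(0)=0\}$. Assume that the network is initially at rest, i.e. $y_i^t=0$ for all $t\le 0$ and all nodes $i$. Then the network $\mathcal{G}$ with heterogeneous nonlinearities $\{f_i\}_{i\in\mathcal{N}}$ is $W$-generically locally identifiable for almost all collections $\{f_i\}_{i\in\mathcal{N}}$ of functions in $\mathcal{F}_Z^{\mathcal{N}}$ if and only if at least one node in each source component of $\mathcal{C}(\mathcal{G})$ is excited and at least one node in each sink component of $\mathcal{C}(\mathcal{G})$ is measured.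
   Context: **Graph.** $\mathcal{G}=(\mathcal{N},\mathcal{E},W)$ is a finite directed graph (cycles and self-loops allowed) with node set $\mathcal{N}$, $n=|\mathcal{N}|$, edge set $\mathcal{E}\subseteq\mathcal{N}\times\mathcal{N}$ and real weight matrix $W=(w_{ij})$. Convention: $(i,j)\in\mathcal{E}$ is the edge from $j$ to $i$ ($j$ influences $i$). A matrix $W$ is consistent with $\mathcal{E}$ if $w_{ij}\neq 0$ only if $(i,j)\in\mathcal{E}$; such matrices are identified with points of $\mathbb{R}^{|\mathcal{E}|}$. The condensation graph $\mathcal{C}(\mathcal{G})$ has as nodes the strongly connected components of $\mathcal{G}$, with an edge $(C,C')$, $C\ne C'$, whenever there is $(u,w)\in\mathcal{E}$ with $u\in C$, $w\in C'$ (i.e. an edge from $C'$ to $C$). A source component has no incoming edges in $\mathcal{C}(\mathcal{G})$; a sink component has no outgoing edges. **Dynamics.** $b_i=1$ if $i\in\mathcal{N}^e$ and $b_i=0$ otherwise; $y_i^t=0$ for $t\le 0$, and for $t\ge 1$ $$y_i^t=f_i\Big(\sum_j w_{ij}y_j^{t-1}\Big)+b_iu_i^{t-1},$$ where $f_i$ is the nonlinearity of node $i$ and $u_i^s\in\mathbb{R}$ $(s\ge 0)$ are arbitrary excitation signals. For $i\in\mathcal{N}^m$ and $t>0$, $F_i^t$ denotes the function of the past inputs $(u_e^s)_{e\in\mathcal{N}^e,\,0\le s\le t-2}$ such that $y_i^t=b_iu_i^{t-1}+F_i^t$; $\tilde F_i^t$ is obtained in the same way from another weight matrix $\tilde W$.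 **Local identifiability.** $\mathcal{E}$ and $\{f_i\}$ are known, $W$ is unknown. The network is locally identifiable (at $W$, for $\{f_i\}$) if there exist $t>0$ and $\epsilon>0$ such that, for every $\tilde W$ consistent with $\mathcal{E}$ with $\|W-\tilde W\|<\epsilon$, the equalities $F_i^t=\tilde F_i^t$ (as functions) for all $i\in\mathcal{N}^m$ imply $W=\tilde W$. It is $W$-generically locally identifiable (for fixed $\{f_i\}$) if it is locally identifiable at all $W$ consistent with $\mathcal{E}$ except possibly those in a set of zero Lebesgue measure in $\mathbb{R}^{|\mathcal{E}|}$. **Genericity in collections.** $\{f_i\}_{i\in\mathcal{N}}\in\mathcal{F}_Z^{\mathcal{N}}$ means $f_i\in\mathcal{F}_Z$ for all $i$; write $f_i(x)=\sum_{k\ge1}a_k^{(i)}x^k$ for the Maclaurin series. A property holds for almost all collections in $\mathcal{F}_Z^{\mathcal{N}}$ if there is $M>0$ and a set $Z\subset\mathbb{R}^{nM}$ of zero Lebesgue measure such that the property holds for every collection in $\mathcal{F}_Z^{\mathcal{N}}$ with $(a_k^{(i)})_{1\le k\le M,\,i\in\mathcal{N}}\notin Z$.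
   Formalization: Added assumption: every node with no incident edge (not even a self-loop) is both excited and measured; otherwise the "only if" fails, e.g. one node, no edges, nothing excited or measured is trivially identifiable. *)

theory Defs
  imports "HOL-Analysis.Analysis" "Graph_Theory.Digraph_Component"
begin

section \<open>Graphs\<close>

text \<open>A pair (i, j) denotes the edge from j to i, so the tail is the second component and the
  head is the first one.\<close>

definition influence_digraph :: "'a set \<Rightarrow> ('a \<times> 'a) set \<Rightarrow> ('a, 'a \<times> 'a) pre_digraph" where
  "influence_digraph N E = \<lparr>verts = N, arcs = E, tail = snd, head = fst\<rparr>"

definition condensation_graph ::
    "'a set \<Rightarrow> ('a \<times> 'a) set \<Rightarrow> ('a set, 'a set \<times> 'a set) pre_digraph" where
  "condensation_graph N E =
     (let S = pre_digraph.sccs_verts (influence_digraph N E)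
      in influence_digraph S
           {(C, C'). C \<in> S \<and> C' \<in> S \<and> C \<noteq> C' \<and> (\<exists>u\<in>C. \<exists>w\<in>C'. (u, w) \<in> E)})"

definition source_components :: "'a set \<Rightarrow> ('a \<times> 'a) set \<Rightarrow> 'a set set" where
  "source_components N E =
     {C \<in> verts (condensation_graph N E). in_arcs (condensation_graph N E) C = {}}"

definition sink_components :: "'a set \<Rightarrow> ('a \<times> 'a) set \<Rightarrow> 'a set set" where
  "sink_components N E =
     {C \<in> verts (condensation_graph N E). out_arcs (condensation_graph N E) C = {}}"

section \<open>Lebesgue measure on coordinate spaces\<close>

text \<open>Points of the coordinate space indexed by a finite set I are the functions in
  \<open>I \<rightarrow>\<^sub>E UNIV\<close> (equal to undefined outside I).\<close>

definition lebesgue_coords :: "'i set \<Rightarrow> ('i \<Rightarrow> real) measure" where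
  "lebesgue_coords I = completion (Pi\<^sub>M I (\<lambda>_. lborel))"

section \<open>Dynamics\<close>

text \<open>The matrix consistent with E that corresponds to a point of the coordinate space
  indexed by E.\<close>

definition weight_matrix :: "('a \<times> 'a) set \<Rightarrow> ('a \<times> 'a \<Rightarrow> real) \<Rightarrow> 'a \<Rightarrow> 'a \<Rightarrow> real" where
  "weight_matrix E w i j = (if (i, j) \<in> E then w (i, j) else 0)"

definition excitation :: "'a set \<Rightarrow> ('a \<Rightarrow> nat \<Rightarrow> real) \<Rightarrow> 'a \<Rightarrow> nat \<Rightarrow> real" where
  "excitation Ne u i s = (if i \<in> Ne then 1 else 0) * u i s"

text \<open>The outputs at negative times, which vanish as well, never enter the recursion.\<close>

primrec node_output :: "'a set \<Rightarrow> ('a \<times> 'a) set \<Rightarrow> 'a set \<Rightarrow> ('a \<Rightarrow> real \<Rightarrow> real) \<Rightarrow>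
    ('a \<times> 'a \<Rightarrow> real) \<Rightarrow> ('a \<Rightarrow> nat \<Rightarrow> real) \<Rightarrow> nat \<Rightarrow> 'a \<Rightarrow> real" where
  "node_output N E Ne f w u 0 = (\<lambda>i. 0)"
| "node_output N E Ne f w u (Suc t) =
     (\<lambda>i. f i (\<Sum>j\<in>N. weight_matrix E w i j * node_output N E Ne f w u t j)
           + excitation Ne u i t)"

text \<open>Only meaningful for \<open>t > 0\<close>. The argument is the whole signal family, but by the congruence
  lemma below only the inputs at excited nodes up to time \<open>t - 2\<close> matter, so equality of two such
  functions is equality as functions of these past inputs.\<close>

definition past_input_fun :: "'a set \<Rightarrow> ('a \<times> 'a) set \<Rightarrow> 'a set \<Rightarrow> ('a \<Rightarrow> real \<Rightarrow> real) \<Rightarrow>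
    ('a \<times> 'a \<Rightarrow> real) \<Rightarrow> nat \<Rightarrow> 'a \<Rightarrow> ('a \<Rightarrow> nat \<Rightarrow> real) \<Rightarrow> real" where
  "past_input_fun N E Ne f w t i =
     (\<lambda>u. node_output N E Ne f w u t i - excitation Ne u i (t - 1))"

lemma node_output_cong:
  assumes "\<And>e s. e \<in> Ne \<Longrightarrow> s < t \<Longrightarrow> u e s = v e s"
  shows "node_output N E Ne f w u t = node_output N E Ne f w v t"
  using assms
proof (induction t)
  case (Suc t)
  then show ?case by (auto simp: excitation_def)
qed simp

lemma past_input_fun_cong:
  assumes "t > 0" and "\<And>e s. e \<in> Ne \<Longrightarrow> s + 2 \<le> t \<Longrightarrow> u e s = v e s"
  shows "past_input_fun N E Ne f w t i u = past_input_fun N E Ne f w t i v"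
proof -
  obtain r where t: "t = Suc r" using assms(1) gr0_implies_Suc by blast
  have "node_output N E Ne f w u r = node_output N E Ne f w v r"
    using assms(2) by (intro node_output_cong) (auto simp: t)
  then show ?thesis by (simp add: past_input_fun_def t)
qed

section \<open>Local identifiability\<close>

definition locally_identifiable :: "'a set \<Rightarrow> ('a \<times> 'a) set \<Rightarrow> 'a set \<Rightarrow> 'a set \<Rightarrow>
    ('a \<Rightarrow> real \<Rightarrow> real) \<Rightarrow> ('a \<times> 'a \<Rightarrow> real) \<Rightarrow> bool" where
  "locally_identifiable N E Ne Nm f w \<longleftrightarrow>
     (\<exists>t>0. \<exists>\<epsilon>>0. \<forall>w' \<in> E \<rightarrow>\<^sub>E UNIV.
        L2_set (\<lambda>e. w e - w' e) E < \<epsilon> \<longrightarrow>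
        (\<forall>i\<in>Nm. past_input_fun N E Ne f w t i = past_input_fun N E Ne f w' t i) \<longrightarrow>
        w = w')"

definition generically_locally_identifiable :: "'a set \<Rightarrow> ('a \<times> 'a) set \<Rightarrow> 'a set \<Rightarrow> 'a set \<Rightarrow>
    ('a \<Rightarrow> real \<Rightarrow> real) \<Rightarrow> bool" where
  "generically_locally_identifiable N E Ne Nm f \<longleftrightarrow>
     (AE w in lebesgue_coords E. locally_identifiable N E Ne Nm f w)"

section \<open>Collections of analytic functions\<close>

definition real_analytic :: "(real \<Rightarrow> real) \<Rightarrow> bool" where
  "real_analytic f \<longleftrightarrow> (\<forall>x. \<exists>A. (\<lambda>h. f (x + h)) has_fps_expansion A)"

definition F_Z :: "(real \<Rightarrow> real) set" where
  "F_Z = {f. real_analytic f \<and> f 0 = 0}"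

definition maclaurin_coeff :: "(real \<Rightarrow> real) \<Rightarrow> nat \<Rightarrow> real" where
  "maclaurin_coeff f k = (deriv ^^ k) f 0 / fact k"

definition almost_all_collections ::
    "'a set \<Rightarrow> (('a \<Rightarrow> real \<Rightarrow> real) \<Rightarrow> bool) \<Rightarrow> bool" where
  "almost_all_collections N P \<longleftrightarrow>
     (\<exists>M>0. \<exists>Z \<in> null_sets (lebesgue_coords (N \<times> {1..M::nat})).
        \<forall>f. (\<forall>i\<in>N. f i \<in> F_Z) \<longrightarrow>
            (\<lambda>(i, k) \<in> N \<times> {1..M}. maclaurin_coeff (f i) k) \<notin> Z \<longrightarrow> P f)"

end

theory Submission
  imports Defs
begin

text \<open>Necessity: a source component without excited node stays at rest, so the weights of the edges
  leaving its nodes are invisible; dually the edges into the nodes of an unmeasured sink component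
  do not influence any measured node.

  Sufficiency: feed the signals \<open>z U\<close> into the network and expand the outputs in powers of \<open>z\<close>. The
  coefficients are polynomials in the weights and in finitely many Maclaurin coefficients, and local
  identifiability at \<open>w\<close> follows once their Jacobian in \<open>w\<close> has full column rank. Full rank is
  the nonvanishing of a polynomial, so one point with full rank gives full rank for almost all
  Maclaurin coefficients and then for almost all weights.

  Such a point exists with all weights 1 and polynomial nonlinearities. Among these choose
  nonlinearities of maximal Jacobian rank. If a column were missing, maximality would force one
  fixed nonzero direction \<open>h\<close> into the kernel for all nonlinearities that agree with the chosen ones
  to first order at finitely many points. Perturbing the nonlinearity of a node \<open>j\<close> by \<open>R\<close> with double
  zeros at the earlier inputs of \<open>j\<close> changes the derivative of the input of a successor \<open>i\<close> by
  \<open>R'(x) \<delta>x + h (i, j) R(x)\<close>, where \<open>x\<close> is the current input of \<open>j\<close>. As \<open>R(x)\<close> and \<open>R'(x)\<close> are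
  arbitrary, \<open>h (i, j) = 0\<close> and \<open>\<delta>x = 0\<close>. Going backwards from the measured nodes this reaches every
  edge.\<close>

section \<open>Algebras of polynomial functions\<close>

text \<open>The subalgebra generated by \<open>G\<close>, over an arbitrary type of points, so that
  one induction serves coefficient vectors, pairs and triples of vectors, and families of
  signals.\<close>

inductive_set polyfuns :: "('p \<Rightarrow> real) set \<Rightarrow> ('p \<Rightarrow> real) set"
  for G :: "('p \<Rightarrow> real) set" where
  const: "(\<lambda>_. c) \<in> polyfuns G"
| gen: "g \<in> G \<Longrightarrow> g \<in> polyfuns G"
| add: "\<lbrakk>p \<in> polyfuns G; q \<in> polyfuns G\<rbrakk> \<Longrightarrow> (\<lambda>x. p x + q x) \<in> polyfuns G"
| mult: "\<lbrakk>p \<in> polyfuns G; q \<in> polyfuns G\<rbrakk> \<Longrightarrow> (\<lambda>x. p x * q x) \<in> polyfuns G"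

lemma polyfuns_minus: "p \<in> polyfuns G \<Longrightarrow> (\<lambda>x. - p x) \<in> polyfuns G"
  using polyfuns.mult[OF polyfuns.const[of "-1"], of p G] by simp

lemma polyfuns_diff:
  "\<lbrakk>p \<in> polyfuns G; q \<in> polyfuns G\<rbrakk> \<Longrightarrow> (\<lambda>x. p x - q x) \<in> polyfuns G"
  using polyfuns.add[OF _ polyfuns_minus, of p G q] by simp

lemma polyfuns_sum:
  assumes "\<And>i. i \<in> I \<Longrightarrow> p i \<in> polyfuns G"
  shows "(\<lambda>x. \<Sum>i\<in>I. p i x) \<in> polyfuns G"
  using assms
  by (induction I rule: infinite_finite_induct) (auto intro: polyfuns.intros)

lemma polyfuns_poly: "p \<in> polyfuns G \<Longrightarrow> (\<lambda>x. poly r (p x)) \<in> polyfuns G"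
  by (induction r) (auto intro: polyfuns.intros)

lemma polyfuns_subst:
  assumes "q \<in> polyfuns G" and "\<And>g. g \<in> G \<Longrightarrow> (\<lambda>x. g (\<phi> x)) \<in> polyfuns H"
  shows "(\<lambda>x. q (\<phi> x)) \<in> polyfuns H"
  using assms(1) by induction (auto intro: polyfuns.intros assms(2))

lemma polyfuns_eqI:
  assumes "q \<in> polyfuns G" and "\<And>g. g \<in> G \<Longrightarrow> g x = g y"
  shows "q x = q y"
  using assms(1) by induction (auto simp: assms(2))

lemma polyfuns_along_curve:
  assumes "q \<in> polyfuns G" and "\<And>g. g \<in> G \<Longrightarrow> \<exists>r. \<forall>s. g (L s) = poly r s"
  shows "\<exists>r. \<forall>s. q (L s) = poly r s"
  using assms(1)
proof induction
  case (const c)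
  show ?case by (rule exI[of _ "[:c:]"]) simp
next
  case (gen g)
  then show ?case by (rule assms(2))
next
  case (add p q)
  then show ?case by (metis poly_add)
next
  case (mult p q)
  then show ?case by (metis poly_mult)
qed

text \<open>Plays the role of irreducibility of the space of points: it makes
  \<open>polyfuns G\<close> free of zero divisors, also for infinitely many generators.\<close>

definition joined_by_lines :: "('p \<Rightarrow> real) set \<Rightarrow> bool" where
  "joined_by_lines G \<longleftrightarrow>
     (\<forall>x y. \<exists>L. L 0 = x \<and> L 1 = y \<and> (\<forall>g\<in>G. \<exists>r. \<forall>s::real. g (L s) = poly r s))"

text \<open>Along a curve through \<open>x\<close> and \<open>y\<close> both factors become
  univariate polynomials with product 0. The one from \<open>q\<close> is nonzero because of
  \<open>y\<close>, so the one from \<open>p\<close> is 0.\<close>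

lemma polyfuns_mult_eq_0:
  assumes G: "joined_by_lines G" and "p \<in> polyfuns G" "q \<in> polyfuns G"
    and "\<And>x. p x * q x = 0" and "q y \<noteq> 0"
  shows "p x = 0"
proof -
  obtain L where L: "L 0 = x" "L 1 = y" "\<And>g. g \<in> G \<Longrightarrow> \<exists>r. \<forall>s. g (L s) = poly r s"
    using G unfolding joined_by_lines_def by metis
  obtain a where a: "\<And>s. p (L s) = poly a s"
    using polyfuns_along_curve[OF assms(2), of L] L(3) by blast
  obtain b where b: "\<And>s. q (L s) = poly b s"
    using polyfuns_along_curve[OF assms(3), of L] L(3) by blast
  have "poly (a * b) s = 0" for s
    using assms(4)[of "L s"] by (simp add: a b)
  then have "a * b = 0" using poly_all_0_iff_0 by blast
  moreover have "b \<noteq> 0" using b[of 1] L(2) assms(5) by auto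
  ultimately have "a = 0" by simp
  then show ?thesis using a[of 0] L(1) by simp
qed

text \<open>Density of the complement of finitely many proper zero sets. The induction removes
  \<open>q\<close> from \<open>F\<close> by passing from \<open>p\<close> to \<open>p * q\<close>,
  which vanishes also where \<open>q\<close> does.\<close>

lemma polyfuns_eq_0_off_zeros:
  assumes G: "joined_by_lines G" and "finite F" "F \<subseteq> polyfuns G" "p \<in> polyfuns G"
    and "\<And>q. q \<in> F \<Longrightarrow> \<exists>y. q y \<noteq> 0"
    and "\<And>x. (\<forall>q\<in>F. q x \<noteq> 0) \<Longrightarrow> p x = 0"
  shows "p x = 0"
  using assms(2-6)
proof (induction F arbitrary: p x)
  case empty
  then show ?case by simp
next
  case (insert q F)
  have *: "p x * q x = 0" for x
  proof (rule insert.IH)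
    show "(\<lambda>x. p x * q x) \<in> polyfuns G" using insert.prems by (auto intro: polyfuns.mult)
    show "p x * q x = 0" if "\<forall>q\<in>F. q x \<noteq> 0" for x
      using insert.prems(4)[of x] that by (cases "q x = 0") auto
  qed (use insert.prems in auto)
  obtain y where "q y \<noteq> 0" using insert.prems(3)[of q] by auto
  then show ?case by (intro polyfuns_mult_eq_0[OF G _ _ *]) (use insert.prems in auto)
qed

lemma polyfuns_measurable:
  assumes "q \<in> polyfuns G" "\<And>g. g \<in> G \<Longrightarrow> g \<in> borel_measurable M"
  shows "q \<in> borel_measurable M"
  using assms(1) by induction (auto intro: assms(2))

section \<open>Zero sets of polynomials are null sets\<close>

abbreviation coords :: "'i set \<Rightarrow> (('i \<Rightarrow> real) \<Rightarrow> real) set" where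
  "coords I \<equiv> (\<lambda>i x. x i) ` I"

text \<open>Tonelli for the indicator of the exceptional set; null slices give a null set because
  \<open>m\<close> makes that set measurable.\<close>

lemma AE_PiM_insert:
  assumes "finite I" "i \<notin> I"
    and m: "{x \<in> space (Pi\<^sub>M (insert i I) (\<lambda>_. lborel)). P x} \<in> sets (Pi\<^sub>M (insert i I) (\<lambda>_. lborel))"
    and ae: "AE x in Pi\<^sub>M I (\<lambda>_. lborel). AE s in lborel. P (x(i := s))"
  shows "AE x in Pi\<^sub>M (insert i I) (\<lambda>_. lborel :: real measure). P x"
proof -
  let ?L = "\<lambda>_. lborel :: real measure" and ?J = "insert i I"
  interpret product_sigma_finite "?L" by standard
  have neg: "{x \<in> space (Pi\<^sub>M ?J ?L). \<not> P x} \<in> sets (Pi\<^sub>M ?J ?L)"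
    using m by (rule sets.sets_Collect_neg)
  let ?f = "indicator {x \<in> space (Pi\<^sub>M ?J ?L). \<not> P x} :: _ \<Rightarrow> ennreal"
  have f: "?f \<in> borel_measurable (Pi\<^sub>M ?J ?L)" using neg by (rule borel_measurable_indicator)
  have "emeasure (Pi\<^sub>M ?J ?L) {x \<in> space (Pi\<^sub>M ?J ?L). \<not> P x} = integral\<^sup>N (Pi\<^sub>M ?J ?L) ?f"
    using neg by simp
  also have "\<dots> = (\<integral>\<^sup>+ x. (\<integral>\<^sup>+ y. ?f (x(i := y)) \<partial>lborel) \<partial>(Pi\<^sub>M I ?L))"
    by (rule product_nn_integral_insert[OF assms(1,2) f])
  also have "\<dots> = (\<integral>\<^sup>+ x. 0 \<partial>(Pi\<^sub>M I ?L))"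
  proof (rule nn_integral_cong_AE, use ae in eventually_elim)
    case (elim x)
    have "(\<integral>\<^sup>+ y. ?f (x(i := y)) \<partial>lborel) = (\<integral>\<^sup>+ y. 0 \<partial>(lborel :: real measure))"
      by (rule nn_integral_cong_AE, use elim in eventually_elim) (simp add: indicator_def)
    then show ?case by simp
  qed
  finally show ?thesis using neg by (subst AE_iff_measurable[OF _ refl]) auto
qed

text \<open>Freezing coordinate \<open>i\<close> at \<open>x0 i\<close> leaves a nonzero polynomial
  in the other coordinates. For almost all values of these the slice in direction \<open>i\<close>
  is a nonzero univariate polynomial, which has finitely many roots.\<close>

lemma AE_polyfun_nonzero:
  assumes "finite I" "q \<in> polyfuns (coords I)" "q x0 \<noteq> 0"
  shows "AE x in Pi\<^sub>M I (\<lambda>_. lborel :: real measure). q x \<noteq> 0"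
  using assms
proof (induction I arbitrary: q x0 rule: finite_induct)
  case empty
  have "q x = q x0" for x by (rule polyfuns_eqI[OF empty.prems(1)]) simp
  then have "q x \<noteq> 0" for x using empty.prems(2) by metis
  then show ?case by simp
next
  case (insert i I)
  have "q \<in> borel_measurable (Pi\<^sub>M (insert i I) (\<lambda>_. lborel))"
    by (rule polyfuns_measurable[OF insert.prems(1)]) auto
  then have m: "{x \<in> space (Pi\<^sub>M (insert i I) (\<lambda>_. lborel)). q x \<noteq> 0}
      \<in> sets (Pi\<^sub>M (insert i I) (\<lambda>_. lborel))"
    by measurable
  have "AE x in Pi\<^sub>M I (\<lambda>_. lborel). q (x(i := x0 i)) \<noteq> 0"
  proof (rule insert.IH)
    show "(\<lambda>x. q (x(i := x0 i))) \<in> polyfuns (coords I)"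
    proof (rule polyfuns_subst[OF insert.prems(1)])
      fix g :: "('a \<Rightarrow> real) \<Rightarrow> real"
      assume "g \<in> coords (insert i I)"
      then obtain j where "g = (\<lambda>x. x j)" "j \<in> insert i I" by auto
      then show "(\<lambda>x. g (x(i := x0 i))) \<in> polyfuns (coords I)"
        by (cases "j = i") (auto intro: polyfuns.const polyfuns.gen)
    qed
    show "q (x0(i := x0 i)) \<noteq> 0" using insert.prems by simp
  qed
  then have "AE x in Pi\<^sub>M I (\<lambda>_. lborel). AE s in lborel. q (x(i := s)) \<noteq> 0"
  proof eventually_elim
    case (elim x)
    have "\<exists>r. \<forall>s. g (x(i := s)) = poly r s" if "g \<in> coords (insert i I)" for g
    proof -
      from that obtain j where "g = (\<lambda>x. x j)" by auto
      then have "\<forall>s. g (x(i := s)) = poly (if j = i then [:0, 1:] else [:x j:]) s" by auto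
      then show ?thesis by blast
    qed
    then obtain r where r: "\<And>s. q (x(i := s)) = poly r s"
      using polyfuns_along_curve[OF insert.prems(1), of "\<lambda>s. x(i := s)"] by blast
    then have "finite {s. poly r s = 0}" using elim by (intro poly_roots_finite) auto
    then have "AE s in lborel. s \<notin> {s. poly r s = 0}"
      by (intro AE_not_in) (simp add: finite_imp_null_set_lborel)
    then show ?case by (auto simp: r)
  qed
  then show ?case by (rule AE_PiM_insert[OF insert.hyps m])
qed

text \<open>The unit cube has measure 1, so the whole space is not a null set.\<close>

lemma lebesgue_coords_AE_E:
  assumes "finite I" "AE x in lebesgue_coords I. P x"
  obtains x where "x \<in> I \<rightarrow>\<^sub>E UNIV" "P x"
proof -
  interpret product_sigma_finite "\<lambda>_. lborel :: real measure" by standard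
  have ae: "AE x in Pi\<^sub>M I (\<lambda>_. lborel). P x"
    using assms(2) unfolding lebesgue_coords_def AE_completion_iff .
  have "emeasure (Pi\<^sub>M I (\<lambda>_. lborel :: real measure)) (Pi\<^sub>E I (\<lambda>_. {0..1})) = 1"
    by (subst emeasure_PiM) (auto simp: assms(1))
  moreover have "Pi\<^sub>E I (\<lambda>_. {0..1}) \<in> sets (Pi\<^sub>M I (\<lambda>_. lborel :: real measure))"
    using assms(1) by (intro sets_PiM_I_finite) auto
  ultimately have "\<not> (\<forall>x \<in> space (Pi\<^sub>M I (\<lambda>_. lborel)). \<not> P x)"
  proof (intro notI)
    assume *: "\<forall>x \<in> space (Pi\<^sub>M I (\<lambda>_. lborel :: real measure)). \<not> P x"
      and 1: "emeasure (Pi\<^sub>M I (\<lambda>_. lborel :: real measure)) (Pi\<^sub>E I (\<lambda>_. {0..1})) = 1"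
      and s: "Pi\<^sub>E I (\<lambda>_. {0..1}) \<in> sets (Pi\<^sub>M I (\<lambda>_. lborel :: real measure))"
    have "AE x in Pi\<^sub>M I (\<lambda>_. lborel :: real measure). False"
      using ae AE_space by eventually_elim (use * in auto)
    then have "AE x in Pi\<^sub>M I (\<lambda>_. lborel :: real measure).
        x \<in> Pi\<^sub>E I (\<lambda>_. {0..1}) \<longleftrightarrow> x \<in> {}"
      by eventually_elim simp
    then have "emeasure (Pi\<^sub>M I (\<lambda>_. lborel :: real measure)) (Pi\<^sub>E I (\<lambda>_. {0..1})) = 0"
      using emeasure_eq_AE[OF _ s, of "{}"] by simp
    with 1 show False by simp
  qed
  then show ?thesis using that by (auto simp: space_PiM)
qed

section \<open>Elimination over an algebra of functions\<close>

text \<open>Combinations of the rows \<open>R\<close>, whose entries depend on a parameter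
  \<open>p\<close>, with coefficients in \<open>polyfuns G\<close>. Avoiding division keeps
  polynomial entries polynomial.\<close>

inductive_set row_span :: "('p \<Rightarrow> real) set \<Rightarrow> ('p \<Rightarrow> 'e \<Rightarrow> real) set \<Rightarrow> ('p \<Rightarrow> 'e \<Rightarrow> real) set"
  for G :: "('p \<Rightarrow> real) set" and R :: "('p \<Rightarrow> 'e \<Rightarrow> real) set" where
  base: "r \<in> R \<Longrightarrow> r \<in> row_span G R"
| add: "\<lbrakk>r \<in> row_span G R; r' \<in> row_span G R\<rbrakk> \<Longrightarrow> (\<lambda>p e. r p e + r' p e) \<in> row_span G R"
| scale: "\<lbrakk>q \<in> polyfuns G; r \<in> row_span G R\<rbrakk> \<Longrightarrow> (\<lambda>p e. q p * r p e) \<in> row_span G R"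

lemma row_span_sum:
  assumes "\<And>i. i \<in> I \<Longrightarrow> r i \<in> row_span G R" and "r0 \<in> row_span G R"
  shows "(\<lambda>p e. \<Sum>i\<in>I. r i p e) \<in> row_span G R"
proof -
  have z: "(\<lambda>p e. 0) \<in> row_span G R"
    using row_span.scale[OF polyfuns.const[of 0] assms(2)] by simp
  show ?thesis using assms(1)
    by (induction I rule: infinite_finite_induct) (auto intro: z row_span.add)
qed

lemma row_span_trans:
  assumes "r \<in> row_span G R'" "R' \<subseteq> row_span G R"
  shows "r \<in> row_span G R"
  using assms(1) by induction (use assms(2) in \<open>auto intro: row_span.intros\<close>)

lemma row_span_kernel:
  assumes "\<rho> \<in> row_span G R" and "\<And>r. r \<in> R \<Longrightarrow> (\<Sum>e\<in>E. r p e * h e) = 0"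
  shows "(\<Sum>e\<in>E. \<rho> p e * h e) = 0"
  using assms(1)
  by induction (simp_all add: assms(2) distrib_right sum.distrib mult.assoc flip: sum_distrib_left)

text \<open>Fraction-free Gaussian elimination: \<open>D\<close> is the product of the pivots.\<close>

lemma row_span_unit_rows:
  assumes "finite E" and "\<And>r e. \<lbrakk>r \<in> R; e \<in> E\<rbrakk> \<Longrightarrow> (\<lambda>p. r p e) \<in> polyfuns G"
    and "\<And>h e. \<lbrakk>\<And>r. r \<in> R \<Longrightarrow> (\<Sum>e\<in>E. r p0 e * h e) = 0; e \<in> E\<rbrakk> \<Longrightarrow> h e = 0"
  shows "\<exists>D \<in> polyfuns G. D p0 \<noteq> 0 \<and>
    (\<forall>e\<in>E. \<exists>\<rho> \<in> row_span G R. \<forall>p. \<forall>e'\<in>E. \<rho> p e' = (if e' = e then D p else 0))"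
  using assms
proof (induction E arbitrary: R rule: finite_induct)
  case empty
  then show ?case by (auto intro!: bexI[of _ "\<lambda>_. 1"] polyfuns.const)
next
  case (insert x E)
  note fin = insert.hyps(1) and x = insert.hyps(2)
  have "\<exists>r\<in>R. r p0 x \<noteq> 0"
  proof (rule ccontr)
    assume c: "\<not> (\<exists>r\<in>R. r p0 x \<noteq> 0)"
    have "(if x = x then 1 else 0 :: real) = 0"
      by (rule insert.prems(2)[of "\<lambda>e. if e = x then 1 else 0"]) (use c fin in \<open>auto intro!: sum.neutral\<close>)
    then show False by simp
  qed
  then obtain r0 where r0: "r0 \<in> R" "r0 p0 x \<noteq> 0" by blast
  \<comment> \<open>Cross-multiplication with the pivot row \<open>r0\<close> clears column
    \<open>x\<close> without dividing.\<close>
  define red where "red r = (\<lambda>p e. r0 p x * r p e + (- r p x) * r0 p e)" for r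
  have ent: "(\<lambda>p. r p e) \<in> polyfuns G" if "r \<in> R" "e \<in> insert x E" for r e
    using insert.prems(1) that by blast
  have red_span: "red ` R \<subseteq> row_span G R"
  proof
    fix r' assume "r' \<in> red ` R"
    then obtain r where r: "r \<in> R" "r' = red r" by blast
    show "r' \<in> row_span G R"
      unfolding r(2) red_def
      by (intro row_span.add row_span.scale polyfuns_minus ent row_span.base r(1) r0(1)) simp_all
  qed
  have "\<exists>D \<in> polyfuns G. D p0 \<noteq> 0 \<and>
    (\<forall>e\<in>E. \<exists>\<rho> \<in> row_span G (red ` R). \<forall>p. \<forall>e'\<in>E. \<rho> p e' = (if e' = e then D p else 0))"
  proof (rule insert.IH)
    show "(\<lambda>p. r p e) \<in> polyfuns G" if "r \<in> red ` R" "e \<in> E" for r e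
    proof -
      from that obtain r' where r': "r' \<in> R" "r = red r'" by auto
      show ?thesis unfolding r'(2) red_def
        by (intro polyfuns.add polyfuns.mult polyfuns_minus ent r'(1) r0(1))
          (use \<open>e \<in> E\<close> in simp_all)
    qed
    show "h e = 0" if h: "\<And>r. r \<in> red ` R \<Longrightarrow> (\<Sum>e\<in>E. r p0 e * h e) = 0" and e: "e \<in> E" for h e
    proof -
      define S where "S r = (\<Sum>e\<in>E. r p0 e * h e)" for r
      \<comment> \<open>Solving the pivot row for coordinate \<open>x\<close> extends a kernel
        vector of the reduced rows to a kernel vector of \<open>R\<close>.\<close>
      define h' where "h' e = (if e = x then - S r0 / r0 p0 x else h e)" for e
      have sum_h': "(\<Sum>e\<in>insert x E. r p0 e * h' e) = r p0 x * h' x + S r" for r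
      proof -
        have "(\<Sum>e\<in>E. r p0 e * h' e) = S r"
          unfolding S_def by (intro sum.cong) (use x in \<open>auto simp: h'_def\<close>)
        then show ?thesis using fin x by simp
      qed
      have "h' e = 0"
      proof (rule insert.prems(2))
        fix r assume r: "r \<in> R"
        have "0 = (\<Sum>e\<in>E. red r p0 e * h e)" using h r by simp
        also have "\<dots> = r0 p0 x * S r - r p0 x * S r0"
          unfolding red_def S_def by (simp add: algebra_simps sum_subtractf sum_distrib_left)
        finally have eq: "r0 p0 x * S r = r p0 x * S r0" by simp
        show "(\<Sum>e\<in>insert x E. r p0 e * h' e) = 0"
          unfolding sum_h' using r0(2) eq by (simp add: h'_def field_simps)
      qed (use e in simp)
      moreover have "e \<noteq> x" using e x by blast
      ultimately show ?thesis by (simp add: h'_def)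
    qed
  qed
  then obtain D \<rho> where D: "D \<in> polyfuns G" "D p0 \<noteq> 0"
    and \<rho>: "\<And>e. e \<in> E \<Longrightarrow> \<rho> e \<in> row_span G (red ` R)"
    and \<rho>_eq: "\<And>e p e'. \<lbrakk>e \<in> E; e' \<in> E\<rbrakk> \<Longrightarrow> \<rho> e p e' = (if e' = e then D p else 0)"
    by metis
  have \<rho>_x: "\<rho> e p x = 0" if "e \<in> E" for e p
    using \<rho>[OF that] by induction (auto simp: red_def)
  have \<rho>_span: "\<rho> e \<in> row_span G R" if "e \<in> E" for e
    using row_span_trans[OF \<rho>[OF that] red_span] .
  define D' where "D' p = D p * r0 p x" for p
  show ?case
  proof (intro bexI[of _ D'] conjI ballI)
    show "D' \<in> polyfuns G" unfolding D'_def
      by (intro polyfuns.mult D ent r0) simp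
    show "D' p0 \<noteq> 0" unfolding D'_def using D r0 by simp
    fix e assume "e \<in> insert x E"
    then consider "e \<in> E" | "e = x" by blast
    then show "\<exists>\<rho> \<in> row_span G R. \<forall>p. \<forall>e'\<in>insert x E. \<rho> p e' = (if e' = e then D' p else 0)"
    proof cases
      case 1
      have "(\<lambda>p e'. r0 p x * \<rho> e p e') \<in> row_span G R"
        by (intro row_span.scale ent r0 \<rho>_span 1) simp
      moreover have "r0 p x * \<rho> e p e' = (if e' = e then D' p else 0)" if "e' \<in> insert x E" for p e'
        using that 1 x by (auto simp: \<rho>_eq \<rho>_x D'_def)
      ultimately show ?thesis
        by (intro bexI[of _ "\<lambda>p e'. r0 p x * \<rho> e p e'"]) auto
    next
      case 2
      \<comment> \<open>Back substitution: the unit rows already found clear the entries of the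
        pivot row outside column \<open>x\<close>.\<close>
      define \<sigma> where "\<sigma> = (\<lambda>p e'. D p * r0 p e' + (\<Sum>d\<in>E. (- r0 p d) * \<rho> d p e'))"
      have "(\<lambda>p e'. (- r0 p d) * \<rho> d p e') \<in> row_span G R" if "d \<in> E" for d
        by (intro row_span.scale polyfuns_minus ent r0(1) \<rho>_span) (use that in simp_all)
      then have "\<sigma> \<in> row_span G R"
        unfolding \<sigma>_def
        by (intro row_span.add[OF row_span.scale[OF D(1) row_span.base[OF r0(1)]]]
            row_span_sum[OF _ row_span.base[OF r0(1)]])
      moreover have "\<sigma> p e' = (if e' = e then D' p else 0)" if "e' \<in> insert x E" for p e'
      proof (cases "e' = x")
        case True
        then show ?thesis using 2 by (simp add: \<sigma>_def D'_def \<rho>_x)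
      next
        case False
        then have "e' \<in> E" using that by simp
        then have "(\<Sum>d\<in>E. (- r0 p d) * \<rho> d p e') = (\<Sum>d\<in>E. if d = e' then - r0 p d * D p else 0)"
          by (intro sum.cong) (auto simp: \<rho>_eq)
        also have "\<dots> = - r0 p e' * D p" using fin \<open>e' \<in> E\<close> by simp
        finally show ?thesis using 2 False by (simp add: \<sigma>_def)
      qed
      ultimately show ?thesis by blast
    qed
  qed
qed

section \<open>Generic local injectivity of polynomial families\<close>

abbreviation coords2 :: "'b set \<Rightarrow> 'e set \<Rightarrow> (('b \<Rightarrow> real) \<times> ('e \<Rightarrow> real) \<Rightarrow> real) set" where
  "coords2 B E \<equiv> (\<lambda>b p. fst p b) ` B \<union> (\<lambda>e p. snd p e) ` E"

abbreviation coords3 ::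
    "'b set \<Rightarrow> 'e set \<Rightarrow> (('b \<Rightarrow> real) \<times> ('e \<Rightarrow> real) \<times> ('e \<Rightarrow> real) \<Rightarrow> real) set" where
  "coords3 B E \<equiv> (\<lambda>b p. fst p b) ` B \<union> (\<lambda>e p. fst (snd p) e) ` E \<union> (\<lambda>e p. snd (snd p) e) ` E"

text \<open>Hadamard's lemma for polynomials: \<open>J\<close> is polynomial in both end points, and
  on the diagonal \<open>w' = w\<close> it is the gradient in the weights. Finite differences thus
  become accessible to linear algebra.\<close>

lemma polyfuns_difference_quotient:
  fixes q :: "('b \<Rightarrow> real) \<times> ('e \<Rightarrow> real) \<Rightarrow> real"
  assumes "finite E" "q \<in> polyfuns (coords2 B E)"
  shows "\<exists>J. (\<forall>e. (\<lambda>p. J p e) \<in> polyfuns (coords3 B E)) \<and>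
    (\<forall>a w w'. q (a, w') - q (a, w) = (\<Sum>e\<in>E. J (a, w, w') e * (w' e - w e)))"
  using assms(2)
proof induction
  case (const c)
  show ?case by (rule exI[of _ "\<lambda>_ _. 0"]) (auto intro: polyfuns.const)
next
  case (gen g)
  then consider b where "b \<in> B" "g = (\<lambda>p. fst p b)" | e where "e \<in> E" "g = (\<lambda>p. snd p e)" by blast
  then show ?case
  proof cases
    case 1
    then show ?thesis by (intro exI[of _ "\<lambda>_ _. 0"]) (auto intro: polyfuns.const)
  next
    case 2
    have *: "w' e - w e = (\<Sum>d\<in>E. (if d = e then 1 else 0) * (w' d - w d))" for w w' :: "'e \<Rightarrow> real"
    proof -
      have "(\<Sum>d\<in>E. (if d = e then 1 else 0) * (w' d - w d)) = (\<Sum>d\<in>E. if d = e then w' d - w d else 0)"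
        by (intro sum.cong) auto
      then show ?thesis using 2 assms(1) by simp
    qed
    show ?thesis
    proof (intro exI[of _ "\<lambda>_ d. if d = e then 1 else 0"] conjI allI)
      show "(\<lambda>p. if d = e then 1 else 0) \<in> polyfuns (coords3 B E)" for d
        by (rule polyfuns.const)
      show "g (a, w') - g (a, w) = (\<Sum>d\<in>E. (if d = e then 1 else 0) * (w' d - w d))" for a w w'
        unfolding 2(2) snd_conv by (rule *)
    qed
  qed
next
  case (add p q)
  from add.IH(1) obtain J where J: "\<And>e. (\<lambda>p. J p e) \<in> polyfuns (coords3 B E)"
      "\<And>a w w'. p (a, w') - p (a, w) = (\<Sum>e\<in>E. J (a, w, w') e * (w' e - w e))"
    by blast
  from add.IH(2) obtain K where K: "\<And>e. (\<lambda>p. K p e) \<in> polyfuns (coords3 B E)"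
      "\<And>a w w'. q (a, w') - q (a, w) = (\<Sum>e\<in>E. K (a, w, w') e * (w' e - w e))"
    by blast
  have "p (a, w') + q (a, w') - (p (a, w) + q (a, w)) =
      (\<Sum>e\<in>E. (J (a, w, w') e + K (a, w, w') e) * (w' e - w e))" for a w w'
    using J(2)[of a w' w] K(2)[of a w' w] by (simp add: distrib_right sum.distrib)
  then show ?case
    by (intro exI[of _ "\<lambda>p e. J p e + K p e"] conjI allI polyfuns.add J(1) K(1))
next
  case (mult p q)
  from mult.IH(1) obtain J where J: "\<And>e. (\<lambda>p. J p e) \<in> polyfuns (coords3 B E)"
      "\<And>a w w'. p (a, w') - p (a, w) = (\<Sum>e\<in>E. J (a, w, w') e * (w' e - w e))"
    by blast
  from mult.IH(2) obtain K where K: "\<And>e. (\<lambda>p. K p e) \<in> polyfuns (coords3 B E)"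
      "\<And>a w w'. q (a, w') - q (a, w) = (\<Sum>e\<in>E. K (a, w, w') e * (w' e - w e))"
    by blast
  \<comment> \<open>Product rule for differences: the increment of \<open>p\<close> is weighted by
    \<open>q\<close> at \<open>w'\<close>, the increment of \<open>q\<close> by \<open>p\<close> at
    \<open>w\<close>.\<close>
  define L where "L t e = J t e * q (fst t, snd (snd t)) + p (fst t, fst (snd t)) * K t e" for t e
  have "(\<lambda>t. p (fst t, fst (snd t))) \<in> polyfuns (coords3 B E)"
    by (rule polyfuns_subst[OF mult.hyps(1)]) (auto intro!: polyfuns.gen)
  moreover have "(\<lambda>t. q (fst t, snd (snd t))) \<in> polyfuns (coords3 B E)"
    by (rule polyfuns_subst[OF mult.hyps(2)]) (auto intro!: polyfuns.gen)
  ultimately have "(\<lambda>t. L t e) \<in> polyfuns (coords3 B E)" for e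
    unfolding L_def by (intro polyfuns.add polyfuns.mult J(1) K(1))
  moreover have "p (a, w') * q (a, w') - p (a, w) * q (a, w) =
      (\<Sum>e\<in>E. L (a, w, w') e * (w' e - w e))" for a w w'
  proof -
    have "(\<Sum>e\<in>E. L (a, w, w') e * (w' e - w e)) =
        q (a, w') * (\<Sum>e\<in>E. J (a, w, w') e * (w' e - w e)) +
        p (a, w) * (\<Sum>e\<in>E. K (a, w, w') e * (w' e - w e))"
      unfolding L_def sum_distrib_left sum.distrib[symmetric]
      by (intro sum.cong refl) (simp add: algebra_simps)
    then show ?thesis
      unfolding J(2)[of a w' w, symmetric] K(2)[of a w' w, symmetric] by (simp add: algebra_simps)
  qed
  ultimately show ?case by blast
qed

lemma L2_set_nth_le: "\<lbrakk>finite E; e \<in> E\<rbrakk> \<Longrightarrow> \<bar>x e\<bar> \<le> L2_set x E"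
  using member_le_L2_set[of E e "\<lambda>e. \<bar>x e\<bar>"] by (simp add: L2_set_def)

text \<open>The filter lets \<open>w'\<close> approach \<open>w\<close> in the distance on
  \<open>E\<close> that local identifiability uses; values outside \<open>E\<close> are left
  free.\<close>

lemma polyfuns_continuous_third:
  assumes "finite E" "q \<in> polyfuns (coords3 B E)"
  shows "((\<lambda>w'. q (a, w, w')) \<longlongrightarrow> q (a, w, w))
    (filtercomap (\<lambda>w'. L2_set (\<lambda>e. w e - w' e) E) (nhds 0))" (is "(_ \<longlongrightarrow> _) ?F")
  using assms(2)
proof induction
  case (gen g)
  have "((\<lambda>w'. w' e) \<longlongrightarrow> w e) ?F" if "e \<in> E" for e
  proof -
    have "((\<lambda>w'. L2_set (\<lambda>e. w e - w' e) E) \<longlongrightarrow> 0) ?F"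
      by (rule filterlim_filtercomap)
    then have "((\<lambda>w'. w e - w' e) \<longlongrightarrow> 0) ?F"
      by (rule Lim_null_comparison[rotated])
        (auto intro!: always_eventually L2_set_nth_le[OF assms(1) that])
    then have "((\<lambda>w'. w e - (w e - w' e)) \<longlongrightarrow> w e - 0) ?F"
      by (intro tendsto_intros)
    then show ?thesis by simp
  qed
  then show ?case using gen by auto
qed (auto intro: tendsto_intros)

text \<open>Elimination on the difference quotients gives \<open>D\<close>, nonzero at
  \<open>(a0, w0, w0)\<close>. Being polynomial, it is nonzero at \<open>(a, w0, w0)\<close> for
  almost all \<open>a\<close>, then at \<open>(a, w, w)\<close> for almost all \<open>w\<close>, and
  by continuity at \<open>(a, w, w')\<close> for \<open>w'\<close> near \<open>w\<close>. Equal
  values of all \<open>q\<close> put \<open>w' - w\<close> into the kernel of the rows, and the unit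
  rows turn this into \<open>D * (w' e - w e) = 0\<close>.\<close>

lemma generic_local_injectivity:
  fixes \<Phi> :: "(('b \<Rightarrow> real) \<times> ('e \<Rightarrow> real) \<Rightarrow> real) set"
  assumes "finite B" "finite E" and \<Phi>: "\<Phi> \<subseteq> polyfuns (coords2 B E)"
    and inj: "\<And>h e. \<lbrakk>\<And>q. q \<in> \<Phi> \<Longrightarrow>
        ((\<lambda>s. q (a0, \<lambda>e. w0 e + s * h e)) has_real_derivative 0) (at 0); e \<in> E\<rbrakk> \<Longrightarrow> h e = 0"
  shows "\<exists>Z \<in> null_sets (lebesgue_coords B). \<forall>a. a \<in> B \<rightarrow>\<^sub>E UNIV \<longrightarrow> a \<notin> Z \<longrightarrow>
    (AE w in lebesgue_coords E. \<exists>\<epsilon>>0. \<forall>w' \<in> E \<rightarrow>\<^sub>E UNIV. L2_set (\<lambda>e. w e - w' e) E < \<epsilon> \<longrightarrow>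
      (\<forall>q\<in>\<Phi>. q (a, w) = q (a, w')) \<longrightarrow> w = w')"
proof -
  let ?G = "coords3 B E"
  have "\<forall>q\<in>\<Phi>. \<exists>J. (\<forall>e. (\<lambda>p. J p e) \<in> polyfuns ?G) \<and>
    (\<forall>a w w'. q (a, w') - q (a, w) = (\<Sum>e\<in>E. J (a, w, w') e * (w' e - w e)))"
    using polyfuns_difference_quotient[OF assms(2)] \<Phi> by blast
  from bchoice[OF this] obtain J where J: "\<And>q e. q \<in> \<Phi> \<Longrightarrow> (\<lambda>p. J q p e) \<in> polyfuns ?G"
    and J_eq: "\<And>q a w w'. q \<in> \<Phi> \<Longrightarrow>
      q (a, w') - q (a, w) = (\<Sum>e\<in>E. J q (a, w, w') e * (w' e - w e))"
    by blast
  have "\<exists>D \<in> polyfuns ?G. D (a0, w0, w0) \<noteq> 0 \<and> (\<forall>e\<in>E. \<exists>\<rho> \<in> row_span ?G (J ` \<Phi>).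
      \<forall>p. \<forall>e'\<in>E. \<rho> p e' = (if e' = e then D p else 0))"
  proof (rule row_span_unit_rows[OF assms(2)])
    show "(\<lambda>p. r p e) \<in> polyfuns ?G" if "r \<in> J ` \<Phi>" for r e using J that by auto
    show "h e = 0" if ker: "\<And>r. r \<in> J ` \<Phi> \<Longrightarrow> (\<Sum>e\<in>E. r (a0, w0, w0) e * h e) = 0"
      and "e \<in> E" for h e
    proof (rule inj[OF _ \<open>e \<in> E\<close>])
      fix q assume q: "q \<in> \<Phi>"
      define W where "W s = (\<lambda>e. w0 e + s * h e)" for s
      have W0: "W 0 = w0" by (simp add: W_def)
      have "\<exists>r. \<forall>s. J q (a0, w0, W s) e = poly r s" for e
      proof (rule polyfuns_along_curve[OF J[OF q]])
        fix g :: "('b \<Rightarrow> real) \<times> ('e \<Rightarrow> real) \<times> ('e \<Rightarrow> real) \<Rightarrow> real"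
        assume "g \<in> ?G"
        then consider b where "g = (\<lambda>p. fst p b)" | d where "g = (\<lambda>p. fst (snd p) d)"
          | d where "g = (\<lambda>p. snd (snd p) d)" by blast
        then show "\<exists>r. \<forall>s. g (a0, w0, W s) = poly r s"
        proof cases
          case 1
          then show ?thesis by (intro exI[of _ "[:a0 b:]"]) simp
        next
          case 2
          then show ?thesis by (intro exI[of _ "[:w0 d:]"]) simp
        next
          case 3
          then show ?thesis by (intro exI[of _ "[:w0 d, h d:]"]) (simp add: W_def)
        qed
      qed
      then obtain r where r: "\<And>e s. J q (a0, w0, W s) e = poly (r e) s" by metis
      \<comment> \<open>\<open>g\<close> is the difference quotient along the line. It is continuous
        and vanishes at 0, so the criterion of Caratheodory gives derivative 0.\<close>
      define g where "g s = (\<Sum>e\<in>E. J q (a0, w0, W s) e * h e)" for s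
      have "q (a0, W s) - q (a0, W 0) = g s * (s - 0)" for s
        unfolding W0 J_eq[OF q] g_def by (simp add: W_def sum_distrib_left sum_distrib_right mult_ac)
      moreover have "isCont g 0" unfolding g_def r by (intro continuous_intros)
      moreover have "g 0 = 0" using ker[of "J q"] q by (simp add: g_def W0)
      ultimately have "((\<lambda>s. q (a0, W s)) has_real_derivative 0) (at 0)"
        unfolding CARAT_DERIV by blast
      then show "((\<lambda>s. q (a0, \<lambda>e. w0 e + s * h e)) has_real_derivative 0) (at 0)"
        by (simp add: W_def)
    qed
  qed
  then obtain D where D: "D \<in> polyfuns ?G" "D (a0, w0, w0) \<noteq> 0"
    and "\<forall>e\<in>E. \<exists>\<rho>. \<rho> \<in> row_span ?G (J ` \<Phi>) \<and>
      (\<forall>p. \<forall>e'\<in>E. \<rho> p e' = (if e' = e then D p else 0))"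
    by blast
  from bchoice[OF this(3)] obtain \<rho> where \<rho>: "\<And>e. e \<in> E \<Longrightarrow> \<rho> e \<in> row_span ?G (J ` \<Phi>)"
    and \<rho>_eq: "\<And>e p e'. \<lbrakk>e \<in> E; e' \<in> E\<rbrakk> \<Longrightarrow> \<rho> e p e' = (if e' = e then D p else 0)"
    by blast
  define Z where "Z = {a \<in> space (Pi\<^sub>M B (\<lambda>_. lborel)). D (a, w0, w0) = 0}"
  have Da: "(\<lambda>a. D (a, w0, w0)) \<in> polyfuns (coords B)"
    by (rule polyfuns_subst[OF D(1), of "\<lambda>a. (a, w0, w0)"]) (auto intro: polyfuns.const polyfuns.gen)
  have "AE a in Pi\<^sub>M B (\<lambda>_. lborel). D (a, w0, w0) \<noteq> 0"
    using AE_polyfun_nonzero[OF assms(1) Da, of a0] D(2) by simp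
  then have "AE a in Pi\<^sub>M B (\<lambda>_. lborel). a \<notin> Z"
    by eventually_elim (simp add: Z_def)
  moreover have "(\<lambda>a. D (a, w0, w0)) \<in> borel_measurable (Pi\<^sub>M B (\<lambda>_. lborel))"
    by (rule polyfuns_measurable[OF Da]) auto
  then have "Z \<in> sets (Pi\<^sub>M B (\<lambda>_. lborel))" unfolding Z_def by measurable
  ultimately have "Z \<in> null_sets (Pi\<^sub>M B (\<lambda>_. lborel))"
    by (simp add: AE_iff_null_sets)
  then have Z: "Z \<in> null_sets (lebesgue_coords B)"
    unfolding lebesgue_coords_def by (rule null_sets_completionI)
  show ?thesis
  proof (rule bexI[OF _ Z], intro allI impI)
    fix a assume a: "a \<in> B \<rightarrow>\<^sub>E UNIV" "a \<notin> Z"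
    then have "D (a, w0, w0) \<noteq> 0" by (auto simp: Z_def space_PiM)
    \<comment> \<open>For this fixed \<open>a\<close> the point \<open>w0\<close> shows that
      \<open>D\<close> on the diagonal is a nonzero polynomial in the weights.\<close>
    have "(\<lambda>w. D (a, w, w)) \<in> polyfuns (coords E)"
      by (rule polyfuns_subst[OF D(1), of "\<lambda>w. (a, w, w)"]) (auto intro: polyfuns.const polyfuns.gen)
    from AE_polyfun_nonzero[OF assms(2) this, of w0]
    have "AE w in Pi\<^sub>M E (\<lambda>_. lborel). D (a, w, w) \<noteq> 0"
      using \<open>D (a, w0, w0) \<noteq> 0\<close> by simp
    then have "AE w in lebesgue_coords E. D (a, w, w) \<noteq> 0"
      unfolding lebesgue_coords_def by (rule AE_completion)
    moreover have "AE w in lebesgue_coords E. w \<in> E \<rightarrow>\<^sub>E UNIV"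
      using AE_space[of "lebesgue_coords E"] by (simp add: lebesgue_coords_def space_PiM)
    ultimately show "AE w in lebesgue_coords E. \<exists>\<epsilon>>0. \<forall>w' \<in> E \<rightarrow>\<^sub>E UNIV.
      L2_set (\<lambda>e. w e - w' e) E < \<epsilon> \<longrightarrow> (\<forall>q\<in>\<Phi>. q (a, w) = q (a, w')) \<longrightarrow> w = w'"
    proof eventually_elim
      case (elim w)
      let ?d = "\<lambda>w'. L2_set (\<lambda>e. w e - w' e) E"
      have "eventually (\<lambda>w'. D (a, w, w') \<noteq> 0) (filtercomap ?d (nhds 0))"
        by (rule tendsto_imp_eventually_ne[OF polyfuns_continuous_third[OF assms(2) D(1)] elim(1)])
      then obtain P where P: "eventually P (nhds 0)" "\<And>w'. P (?d w') \<Longrightarrow> D (a, w, w') \<noteq> 0"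
        by (auto simp: eventually_filtercomap)
      then obtain \<epsilon> where \<epsilon>: "\<epsilon> > 0" "\<And>x. \<bar>x\<bar> < \<epsilon> \<Longrightarrow> P x"
        by (auto simp: eventually_nhds_metric dist_real_def)
      have "w = w'" if w': "w' \<in> E \<rightarrow>\<^sub>E UNIV" "?d w' < \<epsilon>"
        and eq: "\<forall>q\<in>\<Phi>. q (a, w) = q (a, w')" for w'
      proof (rule PiE_ext[OF elim(2) w'(1)])
        fix e assume e: "e \<in> E"
        let ?p = "(a, w, w')"
        have "(\<Sum>e'\<in>E. \<rho> e ?p e' * (w' e' - w e')) = 0"
        proof (rule row_span_kernel[OF \<rho>[OF e]])
          fix r assume "r \<in> J ` \<Phi>"
          then obtain q where q: "q \<in> \<Phi>" "r = J q" by blast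
          show "(\<Sum>e'\<in>E. r ?p e' * (w' e' - w e')) = 0"
            unfolding q(2) J_eq[OF q(1), symmetric] using bspec[OF eq q(1)] by simp
        qed
        moreover have "(\<Sum>e'\<in>E. \<rho> e ?p e' * (w' e' - w e')) =
            (\<Sum>e'\<in>E. if e' = e then D ?p * (w' e' - w e') else 0)"
          by (intro sum.cong) (auto simp: \<rho>_eq e)
        ultimately have "D ?p * (w' e - w e) = 0" using assms(2) e by simp
        moreover have "D ?p \<noteq> 0" using P(2) \<epsilon>(2) w'(2) by (simp add: abs_of_nonneg L2_set_nonneg)
        ultimately show "w e = w' e" by simp
      qed
      then show ?case using \<epsilon>(1) by blast
    qed
  qed
qed

section \<open>Necessity\<close>

text \<open>A pair \<open>(i, j)\<close> is the arc from \<open>j\<close> to \<open>i\<close>, so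
  walks in the digraph follow \<open>E\<close> backwards.\<close>

lemma reachable_influence_iff:
  assumes "E \<subseteq> N \<times> N" "u \<in> N"
  shows "u \<rightarrow>\<^sup>*\<^bsub>influence_digraph N E\<^esub> v \<longleftrightarrow> (v, u) \<in> E\<^sup>*"
proof -
  let ?G = "influence_digraph N E"
  have ends: "arcs_ends ?G = E\<inverse>"
    by (force simp: arcs_ends_def arc_to_ends_def influence_digraph_def)
  have "wf_digraph ?G"
    using assms by unfold_locales (auto simp: influence_digraph_def)
  then interpret wf_digraph ?G .
  have "(u, v) \<in> (E\<inverse>)\<^sup>* \<Longrightarrow> u \<rightarrow>\<^sup>*\<^bsub>?G\<^esub> v"
  proof (induction rule: rtrancl_induct)
    case base
    then show ?case using assms by (intro reachable_refl) (simp add: influence_digraph_def)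
  next
    case (step y z)
    then show ?case using reachable_adj_trans[of u y z] ends by auto
  qed
  moreover have "u \<rightarrow>\<^sup>*\<^bsub>?G\<^esub> v \<Longrightarrow> (u, v) \<in> (E\<inverse>)\<^sup>*"
    using reachable_rtranclI[of ?G u v] ends by simp
  ultimately show ?thesis by (auto simp: rtrancl_converse)
qed

context
  fixes N :: "'a set" and E :: "('a \<times> 'a) set"
  assumes finN: "finite N" and EN: "E \<subseteq> N \<times> N"
begin

lemma wf_influence: "wf_digraph (influence_digraph N E)"
  using EN by unfold_locales (auto simp: influence_digraph_def)

lemma scc_of_influence:
  "u \<in> N \<Longrightarrow> pre_digraph.scc_of (influence_digraph N E) u = {v \<in> N. (v, u) \<in> E\<^sup>* \<and> (u, v) \<in> E\<^sup>*}"
proof -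
  assume u: "u \<in> N"
  interpret wf_digraph "influence_digraph N E" by (rule wf_influence)
  show ?thesis
    unfolding scc_of_def
  proof (intro Collect_cong)
    fix v
    show "(u \<rightarrow>\<^sup>*\<^bsub>influence_digraph N E\<^esub> v \<and> v \<rightarrow>\<^sup>*\<^bsub>influence_digraph N E\<^esub> u) =
        (v \<in> N \<and> (v, u) \<in> E\<^sup>* \<and> (u, v) \<in> E\<^sup>*)"
      using reachable_influence_iff[OF EN u, of v] reachable_influence_iff[OF EN, of v u]
        reachable_in_verts[of v u]
      by (auto simp: influence_digraph_def)
  qed
qed

lemma sccs_verts_influence:
  "pre_digraph.sccs_verts (influence_digraph N E) = pre_digraph.scc_of (influence_digraph N E) ` N"
  using wf_digraph.sccs_verts_conv_scc_of[OF wf_influence] by (simp add: influence_digraph_def)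

text \<open>A predecessor outside \<open>C\<close> lies in another component, and its edge would
  enter \<open>C\<close> in the condensation. Absence of incoming arcs is therefore closure under
  predecessors.\<close>

lemma source_component_iff:
  "C \<in> source_components N E \<longleftrightarrow>
     C \<in> pre_digraph.sccs_verts (influence_digraph N E) \<and> (\<forall>(u, w) \<in> E. u \<in> C \<longrightarrow> w \<in> C)"
  (is "_ \<longleftrightarrow> _ \<and> ?closed")
proof (cases "C \<in> pre_digraph.sccs_verts (influence_digraph N E)")
  case True
  let ?S = "pre_digraph.sccs_verts (influence_digraph N E)"
  have "C \<in> source_components N E \<longleftrightarrow>
      \<not> (\<exists>C'\<in>?S. C \<noteq> C' \<and> (\<exists>u\<in>C. \<exists>w\<in>C'. (u, w) \<in> E))"
    using True by (auto simp: source_components_def condensation_graph_def Let_def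
        influence_digraph_def[of ?S] in_arcs_def)
  also have "\<dots> \<longleftrightarrow> ?closed"
  proof
    assume *: "\<not> (\<exists>C'\<in>?S. C \<noteq> C' \<and> (\<exists>u\<in>C. \<exists>w\<in>C'. (u, w) \<in> E))"
    show ?closed
    proof (clarify, rule ccontr)
      fix u w assume uw: "(u, w) \<in> E" "u \<in> C" "w \<notin> C"
      let ?C' = "pre_digraph.scc_of (influence_digraph N E) w"
      have "w \<in> N" using uw EN by auto
      then have "?C' \<in> ?S" "w \<in> ?C'" by (auto simp: sccs_verts_influence scc_of_influence)
      then show False using * uw by auto
    qed
  next
    assume ?closed
    then show "\<not> (\<exists>C'\<in>?S. C \<noteq> C' \<and> (\<exists>u\<in>C. \<exists>w\<in>C'. (u, w) \<in> E))"
      using wf_digraph.sccs_verts_disjoint[OF wf_influence True] by blast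
  qed
  finally show ?thesis using True by simp
qed (auto simp: source_components_def condensation_graph_def Let_def influence_digraph_def)

lemma sink_component_iff:
  "C \<in> sink_components N E \<longleftrightarrow>
     C \<in> pre_digraph.sccs_verts (influence_digraph N E) \<and> (\<forall>(u, w) \<in> E. w \<in> C \<longrightarrow> u \<in> C)"
  (is "_ \<longleftrightarrow> _ \<and> ?closed")
proof (cases "C \<in> pre_digraph.sccs_verts (influence_digraph N E)")
  case True
  let ?S = "pre_digraph.sccs_verts (influence_digraph N E)"
  have "C \<in> sink_components N E \<longleftrightarrow>
      \<not> (\<exists>C'\<in>?S. C' \<noteq> C \<and> (\<exists>u\<in>C'. \<exists>w\<in>C. (u, w) \<in> E))"
    using True by (auto simp: sink_components_def condensation_graph_def Let_def
        influence_digraph_def[of ?S] out_arcs_def)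
  also have "\<dots> \<longleftrightarrow> ?closed"
  proof
    assume *: "\<not> (\<exists>C'\<in>?S. C' \<noteq> C \<and> (\<exists>u\<in>C'. \<exists>w\<in>C. (u, w) \<in> E))"
    show ?closed
    proof (clarify, rule ccontr)
      fix u w assume uw: "(u, w) \<in> E" "w \<in> C" "u \<notin> C"
      let ?C' = "pre_digraph.scc_of (influence_digraph N E) u"
      have "u \<in> N" using uw EN by auto
      then have "?C' \<in> ?S" "u \<in> ?C'" by (auto simp: sccs_verts_influence scc_of_influence)
      then show False using * uw by auto
    qed
  next
    assume ?closed
    then show "\<not> (\<exists>C'\<in>?S. C' \<noteq> C \<and> (\<exists>u\<in>C'. \<exists>w\<in>C. (u, w) \<in> E))"
      using wf_digraph.sccs_verts_disjoint[OF wf_influence True] by blast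
  qed
  finally show ?thesis using True by simp
qed (auto simp: sink_components_def condensation_graph_def Let_def influence_digraph_def)

end

text \<open>Choose an ancestor \<open>j\<close> with fewest ancestors. If \<open>k\<close> is an
  ancestor of \<open>j\<close>, its ancestors are among those of \<open>j\<close>, so by minimality
  they coincide, and \<open>j\<close> is one of them.\<close>

lemma ex_minimal_ancestor:
  assumes "finite N" "r \<subseteq> N \<times> N" "i \<in> N"
  shows "\<exists>j\<in>N. (j, i) \<in> r\<^sup>* \<and> (\<forall>k. (k, j) \<in> r\<^sup>* \<longrightarrow> (j, k) \<in> r\<^sup>*)"
proof -
  define anc where "anc j = {k. (k, j) \<in> r\<^sup>*}" for j
  have inN: "k \<in> N" if "(k, j) \<in> r\<^sup>*" "j \<in> N" for k j
    using that assms(2) by (induction rule: converse_rtrancl_induct) auto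
  have fin: "finite (anc j)" if "j \<in> N" for j
    using finite_subset[OF _ assms(1), of "anc j"] inN that by (auto simp: anc_def)
  obtain j where j: "j \<in> anc i" and min: "\<And>k. k \<in> anc i \<Longrightarrow> card (anc j) \<le> card (anc k)"
    using ex_min_if_finite[of "(\<lambda>j. card (anc j)) ` anc i"] fin[OF assms(3)]
    by (metis (no_types, lifting) anc_def arg_min_least empty_iff mem_Collect_eq rtrancl.rtrancl_refl
        arg_min_if_finite(1))
  have "(j, k) \<in> r\<^sup>*" if k: "(k, j) \<in> r\<^sup>*" for k
  proof -
    have sub: "anc k \<subseteq> anc j" using k by (auto simp: anc_def)
    have "k \<in> anc i" using k j by (auto simp: anc_def)
    then have "anc k = anc j"
      using card_seteq[OF fin sub] min inN[of j i] j assms(3) by (auto simp: anc_def)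
    then show ?thesis by (auto simp: anc_def)
  qed
  then show ?thesis using j inN assms(3) by (auto simp: anc_def)
qed

lemma excited_ancestor:
  assumes "finite N" "E \<subseteq> N \<times> N" "\<forall>C \<in> source_components N E. \<exists>i\<in>C. i \<in> Ne" "i \<in> N"
  shows "\<exists>e\<in>Ne. (i, e) \<in> E\<^sup>*"
proof -
  obtain j where j: "j \<in> N" "(i, j) \<in> E\<^sup>*" "\<And>k. (j, k) \<in> E\<^sup>* \<Longrightarrow> (k, j) \<in> E\<^sup>*"
    using ex_minimal_ancestor[of N "E\<inverse>" i] assms by (auto simp: rtrancl_converse)
  let ?C = "pre_digraph.scc_of (influence_digraph N E) j"
  have C: "?C = {v \<in> N. (v, j) \<in> E\<^sup>* \<and> (j, v) \<in> E\<^sup>*}"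
    by (rule scc_of_influence[OF assms(1,2) j(1)])
  have "w \<in> ?C" if "(u, w) \<in> E" "u \<in> ?C" for u w
  proof -
    have "(j, w) \<in> E\<^sup>*" using that unfolding C by (auto intro: rtrancl_into_rtrancl)
    then show ?thesis using that j(3)[of w] assms(2) unfolding C by auto
  qed
  then have "?C \<in> source_components N E"
    using source_component_iff[OF assms(1,2)] sccs_verts_influence[OF assms(1,2)] j(1) by auto
  then obtain e where "e \<in> ?C" "e \<in> Ne" using assms(3) by auto
  then show ?thesis using j(2) unfolding C by (intro bexI[of _ e]) auto
qed

lemma measured_descendant:
  assumes "finite N" "E \<subseteq> N \<times> N" "\<forall>C \<in> sink_components N E. \<exists>i\<in>C. i \<in> Nm" "i \<in> N"
  shows "\<exists>m\<in>Nm. (m, i) \<in> E\<^sup>*"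
proof -
  obtain j where j: "j \<in> N" "(j, i) \<in> E\<^sup>*" "\<And>k. (k, j) \<in> E\<^sup>* \<Longrightarrow> (j, k) \<in> E\<^sup>*"
    using ex_minimal_ancestor[of N E i] assms by auto
  let ?C = "pre_digraph.scc_of (influence_digraph N E) j"
  have C: "?C = {v \<in> N. (v, j) \<in> E\<^sup>* \<and> (j, v) \<in> E\<^sup>*}"
    by (rule scc_of_influence[OF assms(1,2) j(1)])
  have "u \<in> ?C" if "(u, w) \<in> E" "w \<in> ?C" for u w
  proof -
    have "(u, j) \<in> E\<^sup>*" using that unfolding C by (auto intro: converse_rtrancl_into_rtrancl)
    then show ?thesis using that j(3)[of u] assms(2) unfolding C by auto
  qed
  then have "?C \<in> sink_components N E"
    using sink_component_iff[OF assms(1,2)] sccs_verts_influence[OF assms(1,2)] j(1) by auto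
  then obtain m where "m \<in> ?C" "m \<in> Nm" using assms(3) by auto
  then show ?thesis using j(2) unfolding C by (intro bexI[of _ m]) auto
qed

section \<open>Weights without visible effect\<close>

lemma node_output_silent:
  assumes "\<forall>(u, w) \<in> E. u \<in> C \<longrightarrow> w \<in> C" "C \<inter> Ne = {}" "\<And>i. i \<in> C \<Longrightarrow> f i 0 = 0" "i \<in> C"
  shows "node_output N E Ne f w u t i = 0"
  using assms(4)
proof (induction t arbitrary: i)
  case (Suc t)
  have "(\<Sum>j\<in>N. weight_matrix E w i j * node_output N E Ne f w u t j) = 0"
    using assms(1) Suc by (intro sum.neutral ballI) (auto simp: weight_matrix_def)
  then show ?case using Suc.prems assms(2,3) by (auto simp: excitation_def)
qed simp

text \<open>The tail \<open>j\<close> of the edge stays at 0, so the weight only ever multiplies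
  0.\<close>

lemma node_output_silent_edge:
  assumes "\<forall>(u, w) \<in> E. u \<in> C \<longrightarrow> w \<in> C" "C \<inter> Ne = {}" "\<And>i. i \<in> C \<Longrightarrow> f i 0 = 0"
    and "e = (k, j)" "j \<in> C"
  shows "node_output N E Ne f (w(e := c)) u t = node_output N E Ne f w u t"
proof (induction t)
  case (Suc t)
  have "node_output N E Ne f w u t j = 0"
    by (rule node_output_silent[OF assms(1,2) _ assms(5)]) (rule assms(3))
  then have "weight_matrix E (w(e := c)) i l * node_output N E Ne f w u t l =
      weight_matrix E w i l * node_output N E Ne f w u t l" for i l
    using assms(4) by (cases "l = j") (auto simp: weight_matrix_def)
  then show ?case by (simp only: node_output.simps Suc)
qed simp

text \<open>No edge leaves \<open>C\<close>, so nodes outside never receive an output from inside,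
  and the altered weight enters only the sum formed at \<open>k\<close> in \<open>C\<close>.\<close>

lemma node_output_hidden_edge:
  assumes "\<forall>(u, w) \<in> E. w \<in> C \<longrightarrow> u \<in> C" "e = (k, j)" "k \<in> C" "i \<notin> C"
  shows "node_output N E Ne f (w(e := c)) u t i = node_output N E Ne f w u t i"
  using assms(4)
proof (induction t arbitrary: i)
  case (Suc t)
  have "weight_matrix E (w(e := c)) i l * node_output N E Ne f (w(e := c)) u t l =
      weight_matrix E w i l * node_output N E Ne f w u t l" for l
  proof (cases "l \<in> C")
    case True
    then have "(i, l) \<notin> E" using assms(1) Suc.prems by auto
    then show ?thesis by (simp add: weight_matrix_def)
  next
    case False
    have "i \<noteq> k" using Suc.prems assms(3) by blast
    then have "weight_matrix E (w(e := c)) i l = weight_matrix E w i l"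
      using assms(2) by (simp add: weight_matrix_def)
    then show ?thesis using Suc.IH[OF False] by (simp del: fun_upd_apply)
  qed
  then show ?case by (simp del: fun_upd_apply)
qed simp

lemma not_locally_identifiable_edge:
  assumes "finite E" "e \<in> E" "w \<in> E \<rightarrow>\<^sub>E UNIV"
    and "\<And>c t i. i \<in> Nm \<Longrightarrow> past_input_fun N E Ne f (w(e := c)) t i = past_input_fun N E Ne f w t i"
  shows "\<not> locally_identifiable N E Ne Nm f w"
proof
  assume "locally_identifiable N E Ne Nm f w"
  then obtain t \<epsilon> where "\<epsilon> > 0" and *: "\<And>w'. \<lbrakk>w' \<in> E \<rightarrow>\<^sub>E UNIV; L2_set (\<lambda>e. w e - w' e) E < \<epsilon>;
      \<forall>i\<in>Nm. past_input_fun N E Ne f w t i = past_input_fun N E Ne f w' t i\<rbrakk> \<Longrightarrow> w = w'"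
    unfolding locally_identifiable_def by blast
  define w' where "w' = w(e := w e + \<epsilon> / 2)"
  have "L2_set (\<lambda>d. w d - w' d) E \<le> (\<Sum>d\<in>E. \<bar>w d - w' d\<bar>)"
    by (rule L2_set_le_sum_abs)
  also have "\<dots> = (\<Sum>d\<in>E. if d = e then \<epsilon> / 2 else 0)"
    using \<open>\<epsilon> > 0\<close> by (intro sum.cong) (auto simp: w'_def)
  also have "\<dots> < \<epsilon>" using assms(1,2) \<open>\<epsilon> > 0\<close> by simp
  finally have "w = w'"
    using * assms(2,3,4) unfolding w'_def by (auto simp: PiE_def extensional_def)
  then have "w e = w' e" by simp
  then show False using \<open>\<epsilon> > 0\<close> by (simp add: w'_def)
qed

section \<open>Maclaurin coefficients and the necessary condition\<close>

lemma has_fps_expansion_poly: "poly p has_fps_expansion fps_of_poly p"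
  for p :: "real poly"
  by (simp add: has_fps_expansion_def)

lemma maclaurin_coeff_eq:
  assumes "f has_fps_expansion A"
  shows "maclaurin_coeff f k = fps_nth A k"
proof -
  have "(deriv ^^ k) f 0 = fact k * fps_nth A k"
    using assms
  proof (induction k arbitrary: f A)
    case 0
    then have "eventually (\<lambda>z. eval_fps A z = f z) (nhds 0)" by (simp add: has_fps_expansion_def)
    then have "eval_fps A 0 = f 0" by (rule eventually_nhds_x_imp_x)
    then show ?case by (simp add: eval_fps_at_0)
  next
    case (Suc k)
    have "(deriv ^^ Suc k) f 0 = (deriv ^^ k) (deriv f) 0"
      by (simp add: funpow_Suc_right del: funpow.simps)
    also have "\<dots> = fact k * fps_nth (fps_deriv A) k"
      by (rule Suc.IH, rule has_fps_expansion_deriv, rule Suc.prems)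
    finally show ?case by (simp add: algebra_simps)
  qed
  then show ?thesis by (simp add: maclaurin_coeff_def)
qed

lemma poly_in_F_Z:
  assumes "coeff p 0 = 0"
  shows "poly p \<in> F_Z"
proof -
  have "(\<lambda>h. poly p (x + h)) has_fps_expansion fps_of_poly (pcompose p [:x, 1:])" for x
  proof -
    have "poly (pcompose p [:x, 1:]) = (\<lambda>h. poly p (x + h))" by (simp add: fun_eq_iff poly_pcompose)
    then show ?thesis using has_fps_expansion_poly[of "pcompose p [:x, 1:]"] by simp
  qed
  then show ?thesis using assms by (auto simp: F_Z_def real_analytic_def poly_0_coeff_0)
qed

text \<open>Some coefficient vector lies outside the null set, and the polynomials with exactly
  these coefficients belong to \<open>F_Z\<close>.\<close>

lemma almost_all_collections_witness:
  assumes "finite N" "almost_all_collections N P"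
  obtains f where "\<And>i. f i \<in> F_Z" "P f"
proof -
  obtain M Z where Z: "Z \<in> null_sets (lebesgue_coords (N \<times> {1..M::nat}))"
    and P: "\<And>f. \<lbrakk>\<forall>i\<in>N. f i \<in> F_Z;
      (\<lambda>(i, k) \<in> N \<times> {1..M}. maclaurin_coeff (f i) k) \<notin> Z\<rbrakk> \<Longrightarrow> P f"
    using assms(2) unfolding almost_all_collections_def by blast
  obtain a where a: "a \<in> N \<times> {1..M} \<rightarrow>\<^sub>E UNIV" "a \<notin> Z"
    using lebesgue_coords_AE_E[OF _ AE_not_in[OF Z]] assms(1) by auto
  define p where "p i = (\<Sum>k = 1..M. monom (a (i, k)) k)" for i
  have coeff: "coeff (p i) k = (if k \<in> {1..M} then a (i, k) else 0)" for i k
    unfolding p_def by (simp add: coeff_sum)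
  have F: "poly (p i) \<in> F_Z" for i by (rule poly_in_F_Z) (simp add: coeff)
  have "(\<lambda>(i, k) \<in> N \<times> {1..M}. maclaurin_coeff (poly (p i)) k) = a"
    using a(1) by (auto simp: fun_eq_iff maclaurin_coeff_eq[OF has_fps_expansion_poly] coeff
        restrict_def PiE_def extensional_def)
  then show ?thesis using that[of "\<lambda>i. poly (p i)"] P[of "\<lambda>i. poly (p i)"] F a(2) by auto
qed

lemma excitation_measurement_necessary:
  assumes "finite N" "E \<subseteq> N \<times> N"
    and isolated: "\<And>i. i \<in> N \<Longrightarrow> \<forall>j. (i, j) \<notin> E \<and> (j, i) \<notin> E \<Longrightarrow> i \<in> Ne \<and> i \<in> Nm"
    and gen: "almost_all_collections N (\<lambda>f. generically_locally_identifiable N E Ne Nm f)"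
  shows "(\<forall>C \<in> source_components N E. \<exists>i\<in>C. i \<in> Ne) \<and>
    (\<forall>C \<in> sink_components N E. \<exists>i\<in>C. i \<in> Nm)"
proof -
  have finE: "finite E" using assms(1,2) finite_subset by blast
  obtain f where f: "\<And>i. f i \<in> F_Z" "generically_locally_identifiable N E Ne Nm f"
    using almost_all_collections_witness[OF assms(1) gen] by blast
  obtain w where w: "w \<in> E \<rightarrow>\<^sub>E UNIV" "locally_identifiable N E Ne Nm f w"
    using lebesgue_coords_AE_E[OF finE] f(2) unfolding generically_locally_identifiable_def by blast
  have f0: "f i 0 = 0" for i using f(1)[of i] by (simp add: F_Z_def)
  have scc: "\<exists>c\<in>C. c \<in> N" if "C \<in> pre_digraph.sccs_verts (influence_digraph N E)" for C
    using that by (auto simp: sccs_verts_influence[OF assms(1,2)] scc_of_influence[OF assms(1,2)])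
  have "\<exists>i\<in>C. i \<in> Ne" if C: "C \<in> source_components N E" for C
  proof (rule ccontr)
    assume "\<not> (\<exists>i\<in>C. i \<in> Ne)"
    then have C': "C \<inter> Ne = {}" by auto
    have closed: "\<forall>(u, w) \<in> E. u \<in> C \<longrightarrow> w \<in> C"
      using C source_component_iff[OF assms(1,2)] by blast
    obtain c where c: "c \<in> C" "c \<in> N" using C source_component_iff[OF assms(1,2)] scc by blast
    \<comment> \<open>By \<open>isolated\<close> the unexcited node \<open>c\<close> touches an
      edge; since \<open>C\<close> is closed under predecessors, the tail of that edge lies in
      \<open>C\<close> in either case.\<close>
    then have "\<exists>j. (c, j) \<in> E \<or> (j, c) \<in> E" using isolated[of c] C' by blast
    then obtain k j where e: "(k, j) \<in> E" "j \<in> C" using closed c by blast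
    show False
      using not_locally_identifiable_edge[OF finE e(1) w(1)] w(2)
        node_output_silent_edge[OF closed C' _ refl e(2)] f0
      by (auto simp: past_input_fun_def)
  qed
  moreover have "\<exists>i\<in>C. i \<in> Nm" if C: "C \<in> sink_components N E" for C
  proof (rule ccontr)
    assume C': "\<not> (\<exists>i\<in>C. i \<in> Nm)"
    have closed: "\<forall>(u, w) \<in> E. w \<in> C \<longrightarrow> u \<in> C"
      using C sink_component_iff[OF assms(1,2)] by blast
    obtain c where c: "c \<in> C" "c \<in> N" using C sink_component_iff[OF assms(1,2)] scc by blast
    then have "\<exists>j. (c, j) \<in> E \<or> (j, c) \<in> E" using isolated[of c] C' by blast
    then obtain k j where e: "(k, j) \<in> E" "k \<in> C" using closed c by blast
    have "past_input_fun N E Ne f (w((k, j) := c)) t i = past_input_fun N E Ne f w t i"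
      if "i \<in> Nm" for c t i
      unfolding past_input_fun_def
      using node_output_hidden_edge[OF closed refl e(2)] C' that by (intro ext) metis
    then show False
      using not_locally_identifiable_edge[OF finE e(1) w(1)] w(2) by blast
  qed
  ultimately show ?thesis by blast
qed

section \<open>Rigidity of the Jacobian kernel\<close>

text \<open>Let \<open>S\<close> vanish exactly on \<open>C\<close>. The product of the square of
  \<open>S\<close> with \<open>[:- x, 1:]\<close> has value 0 and nonzero derivative at
  \<open>x\<close>, which isolates \<alpha>; the square of \<open>S\<close> alone is nonzero at
  \<open>x\<close> and then isolates \<beta>.\<close>

lemma double_root_separation:
  fixes x :: real
  assumes "finite C" "x \<notin> C"
    and "\<And>R. (\<And>c. c \<in> C \<Longrightarrow> poly R c = 0 \<and> poly (pderiv R) c = 0) \<Longrightarrow>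
      poly (pderiv R) x * \<alpha> + \<beta> * poly R x = 0"
  shows "\<alpha> = 0" "\<beta> = 0"
proof -
  define S where "S = (\<Prod>c\<in>C. [:- c, 1:])"
  have S: "poly S c = 0" if "c \<in> C" for c
    using that assms(1) by (auto simp: S_def poly_prod)
  have Sx: "poly S x \<noteq> 0" using assms(1,2) by (auto simp: S_def poly_prod)
  have van: "poly (S * S * Q) c = 0 \<and> poly (pderiv (S * S * Q)) c = 0" if "c \<in> C" for Q c
    using S[OF that] by (simp add: pderiv_mult)
  have "poly (pderiv (S * S * [:- x, 1:])) x = poly S x * poly S x"
    unfolding pderiv_mult[of "S * S" "[:- x, 1:]"] by (simp add: pderiv_pCons)
  then show "\<alpha> = 0"
    using assms(3)[of "S * S * [:- x, 1:]", OF van] Sx by (simp del: mult_pCons_right)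
  then show "\<beta> = 0"
    using assms(3)[of "S * S * 1", OF van] Sx by simp
qed

section \<open>The network at the base point\<close>

locale network =
  fixes N :: "'a set" and E :: "('a \<times> 'a) set" and Ne Nm :: "'a set"
  assumes finN: "finite N" and EN: "E \<subseteq> N \<times> N" and NeN: "Ne \<subseteq> N" and NmN: "Nm \<subseteq> N"

context network
begin

text \<open>The network at the base point where all weights are 1 and the nonlinearities are
  polynomials. Below \<open>dout\<close> is the derivative of \<open>out\<close> in direction \<open>h\<close> with respect to the
  weights.\<close>

abbreviation out :: "('a \<Rightarrow> real poly) \<Rightarrow> ('a \<Rightarrow> nat \<Rightarrow> real) \<Rightarrow> nat \<Rightarrow> 'a \<Rightarrow> real" where
  "out A \<equiv> node_output N E Ne (\<lambda>i. poly (A i)) (\<lambda>_. 1)"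

text \<open>The argument of the nonlinearity of \<open>i\<close> at time \<open>t\<close>, which
  shapes the output at time \<open>t + 1\<close>. Its derivative in direction \<open>h\<close> is
  \<open>dinp\<close>.\<close>

definition inp :: "('a \<Rightarrow> real poly) \<Rightarrow> ('a \<Rightarrow> nat \<Rightarrow> real) \<Rightarrow> nat \<Rightarrow> 'a \<Rightarrow> real" where
  "inp A U t i = (\<Sum>j\<in>N. weight_matrix E (\<lambda>_. 1) i j * out A U t j)"

primrec dout :: "('a \<Rightarrow> real poly) \<Rightarrow> ('a \<times> 'a \<Rightarrow> real) \<Rightarrow> ('a \<Rightarrow> nat \<Rightarrow> real) \<Rightarrow> nat \<Rightarrow> 'a \<Rightarrow> real"
  where
  "dout A h U 0 = (\<lambda>i. 0)"
| "dout A h U (Suc t) = (\<lambda>i. poly (pderiv (A i)) (inp A U t i) *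
     (\<Sum>j\<in>N. weight_matrix E (\<lambda>_. 1) i j * dout A h U t j + weight_matrix E h i j * out A U t j))"

definition dinp ::
    "('a \<Rightarrow> real poly) \<Rightarrow> ('a \<times> 'a \<Rightarrow> real) \<Rightarrow> ('a \<Rightarrow> nat \<Rightarrow> real) \<Rightarrow> nat \<Rightarrow> 'a \<Rightarrow> real" where
  "dinp A h U t i =
     (\<Sum>j\<in>N. weight_matrix E (\<lambda>_. 1) i j * dout A h U t j + weight_matrix E h i j * out A U t j)"

lemma out_Suc: "out A U (Suc t) i = poly (A i) (inp A U t i) + excitation Ne U i t"
  by (simp add: inp_def)

lemma dout_Suc: "dout A h U (Suc t) i = poly (pderiv (A i)) (inp A U t i) * dinp A h U t i"
  by (simp add: dinp_def)

declare node_output.simps(2) [simp del] dout.simps(2) [simp del]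

lemma dout_is_derivative:
  "((\<lambda>s. node_output N E Ne (\<lambda>i. poly (A i)) (\<lambda>e. 1 + s * h e) U t i)
     has_real_derivative dout A h U t i) (at 0)"
proof (induction t arbitrary: i)
  case (Suc t)
  let ?y = "\<lambda>s. node_output N E Ne (\<lambda>i. poly (A i)) (\<lambda>e. 1 + s * h e) U t"
  have w: "weight_matrix E (\<lambda>e. 1 + s * h e) i j =
      weight_matrix E (\<lambda>_. 1) i j + s * weight_matrix E h i j" for s j
    by (simp add: weight_matrix_def)
  have y0: "?y 0 j = out A U t j" for j by simp
  have "((\<lambda>s. weight_matrix E (\<lambda>e. 1 + s * h e) i j * ?y s j) has_real_derivative
      weight_matrix E (\<lambda>_. 1) i j * dout A h U t j + weight_matrix E h i j * out A U t j) (at 0)" for j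
    unfolding w by (rule derivative_eq_intros Suc.IH refl | simp)+
  then have "((\<lambda>s. \<Sum>j\<in>N. weight_matrix E (\<lambda>e. 1 + s * h e) i j * ?y s j)
      has_real_derivative dinp A h U t i) (at 0)" (is "(?x has_real_derivative _) _")
    unfolding dinp_def by (rule DERIV_sum)
  moreover have "?x 0 = inp A U t i" by (simp add: inp_def)
  ultimately have "((\<lambda>s. poly (A i) (?x s)) has_real_derivative dout A h U (Suc t) i) (at 0)"
    unfolding dout_Suc using DERIV_chain2[where f = "poly (A i)" and g = ?x and x = 0] poly_DERIV
    by fastforce
  then have "((\<lambda>s. poly (A i) (?x s) + excitation Ne U i t) has_real_derivative
      dout A h U (Suc t) i + 0) (at 0)"
    by (rule DERIV_add[OF _ DERIV_const])
  then show ?case by (simp add: node_output.simps(2))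
qed simp

lemma dout_linear:
  "dout A (\<lambda>e. \<alpha> * h e + \<beta> * g e) U t i = \<alpha> * dout A h U t i + \<beta> * dout A g U t i"
proof (induction t arbitrary: i)
  case (Suc t)
  have "weight_matrix E (\<lambda>e. \<alpha> * h e + \<beta> * g e) i j =
      \<alpha> * weight_matrix E h i j + \<beta> * weight_matrix E g i j" for j
    by (simp add: weight_matrix_def)
  then have "dinp A (\<lambda>e. \<alpha> * h e + \<beta> * g e) U t i = \<alpha> * dinp A h U t i + \<beta> * dinp A g U t i"
    unfolding dinp_def Suc by (simp add: sum_distrib_left sum.distrib algebra_simps)
  then show ?case by (simp add: dout_Suc algebra_simps)
qed simp

lemma dout_cong:
  assumes "\<And>e. e \<in> E \<Longrightarrow> h e = g e"
  shows "dout A h U t = dout A g U t"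
proof (induction t)
  case (Suc t)
  have "weight_matrix E h = weight_matrix E g"
    by (intro ext) (simp add: weight_matrix_def assms)
  then show ?case using Suc by (simp add: dout.simps(2))
qed simp

text \<open>Up to time \<open>t\<close> the recursions for \<open>out\<close> and
  \<open>dout\<close> evaluate the nonlinearities and their first derivatives at earlier inputs
  only, and never a second derivative.\<close>

lemma first_order_agreement:
  assumes "\<And>\<tau> i. \<lbrakk>\<tau> < t; i \<in> N\<rbrakk> \<Longrightarrow> poly (A' i) (inp A U \<tau> i) = poly (A i) (inp A U \<tau> i) \<and>
      poly (pderiv (A' i)) (inp A U \<tau> i) = poly (pderiv (A i)) (inp A U \<tau> i)"
    and "\<tau> \<le> t" "i \<in> N"
  shows "out A' U \<tau> i = out A U \<tau> i \<and> dout A' h U \<tau> i = dout A h U \<tau> i"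
  using assms(2,3)
proof (induction \<tau> arbitrary: i)
  case (Suc \<tau>)
  have "inp A' U \<tau> i = inp A U \<tau> i" "dinp A' h U \<tau> i = dinp A h U \<tau> i"
    unfolding inp_def dinp_def using Suc by (auto intro!: sum.cong)
  then show ?case using Suc.prems assms(1)[of \<tau> i] by (simp add: out_Suc dout_Suc)
qed simp

lemma first_order_agreement_inp:
  assumes "\<And>\<tau> i. \<lbrakk>\<tau> < t; i \<in> N\<rbrakk> \<Longrightarrow> poly (A' i) (inp A U \<tau> i) = poly (A i) (inp A U \<tau> i) \<and>
      poly (pderiv (A' i)) (inp A U \<tau> i) = poly (pderiv (A i)) (inp A U \<tau> i)"
  shows "inp A' U t i = inp A U t i \<and> dinp A' h U t i = dinp A h U t i"
  unfolding inp_def dinp_def using first_order_agreement[OF assms, where \<tau> = t and h = h]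
  by (auto intro!: sum.cong)

section \<open>Polynomial dependence on the signals\<close>

abbreviation signals :: "(('a \<Rightarrow> nat \<Rightarrow> real) \<Rightarrow> real) set" where
  "signals \<equiv> range (\<lambda>(i, t) U. U i t)"

lemma joined_by_lines_signals: "joined_by_lines signals"
  unfolding joined_by_lines_def
proof (intro allI)
  fix U V :: "'a \<Rightarrow> nat \<Rightarrow> real"
  have "\<exists>r. \<forall>s::real. g (\<lambda>i t. U i t + s * (V i t - U i t)) = poly r s" if "g \<in> signals" for g
  proof -
    from that obtain i t where g: "g = (\<lambda>U. U i t)" by auto
    show ?thesis unfolding g by (intro exI[of _ "[:U i t, V i t - U i t:]"]) simp
  qed
  then show "\<exists>L. L 0 = U \<and> L 1 = V \<and> (\<forall>g\<in>signals. \<exists>r. \<forall>s::real. g (L s) = poly r s)"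
    by (intro exI[of _ "\<lambda>s i t. U i t + s * (V i t - U i t)"]) auto
qed

text \<open>Polynomial dependence lets identities that hold for generic signals extend to all
  signals.\<close>

lemma polyfuns_out: "(\<lambda>U. out A U t i) \<in> polyfuns signals"
proof (induction t arbitrary: i)
  case (Suc t)
  have "(\<lambda>U. U i t) \<in> signals" by (rule range_eqI[of _ _ "(i, t)"]) simp
  then have "(\<lambda>U. excitation Ne U i t) \<in> polyfuns signals"
    unfolding excitation_def by (intro polyfuns.mult polyfuns.const polyfuns.gen)
  then show ?case unfolding out_Suc inp_def
    by (intro polyfuns.add polyfuns_poly polyfuns_sum polyfuns.mult polyfuns.const Suc)
qed (simp add: polyfuns.const)

lemma polyfuns_inp: "(\<lambda>U. inp A U t i) \<in> polyfuns signals"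
  unfolding inp_def by (intro polyfuns_sum polyfuns.mult polyfuns.const polyfuns_out)

lemma polyfuns_dout: "(\<lambda>U. dout A h U t i) \<in> polyfuns signals"
proof (induction t arbitrary: i)
  case (Suc t)
  show ?case unfolding dout_Suc dinp_def
    by (intro polyfuns.add polyfuns_poly polyfuns_inp polyfuns_sum polyfuns.mult polyfuns.const
        polyfuns_out Suc)
qed (simp add: polyfuns.const)

lemma polyfuns_dinp: "(\<lambda>U. dinp A h U t i) \<in> polyfuns signals"
  unfolding dinp_def
  by (intro polyfuns_sum polyfuns.mult polyfuns.const polyfuns_out polyfuns_dout polyfuns.add)

section \<open>Impulse responses\<close>

definition impulse :: "nat \<Rightarrow> real \<Rightarrow> 'a \<Rightarrow> nat \<Rightarrow> real" where
  "impulse s0 s = (\<lambda>i t. if t = s0 then s else 0)"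

text \<open>Nothing arises from rest, so a nonzero output traces back, one edge per time step, to an
  excited node hit by the impulse. The impulse at \<open>s0\<close> first shows in the output at
  \<open>s0 + 1\<close>, whence the length \<open>t - Suc s0\<close>.\<close>

lemma impulse_response_support:
  assumes "\<And>i. poly (A i) 0 = 0" "out A (impulse s0 s) t i \<noteq> 0"
  shows "s0 < t \<and> (\<exists>e\<in>Ne. (i, e) \<in> E ^^ (t - Suc s0))"
  using assms(2)
proof (induction t arbitrary: i)
  case (Suc t)
  show ?case
  proof (cases "inp A (impulse s0 s) t i = 0")
    case True
    then have "excitation Ne (impulse s0 s) i t \<noteq> 0"
      using Suc.prems assms(1) by (simp add: out_Suc)
    then show ?thesis by (auto simp: excitation_def impulse_def split: if_splits)
  next
    case False
    then obtain j where j: "weight_matrix E (\<lambda>_. 1) i j * out A (impulse s0 s) t j \<noteq> 0"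
      unfolding inp_def by (metis (no_types, lifting) sum.neutral)
    then have ij: "(i, j) \<in> E" by (auto simp: weight_matrix_def split: if_splits)
    obtain e where e: "s0 < t" "e \<in> Ne" "(j, e) \<in> E ^^ (t - Suc s0)"
      using Suc.IH[of j] j by auto
    have "(i, e) \<in> E ^^ Suc (t - Suc s0)" using ij e(3) by (rule relpow_Suc_I2)
    moreover have "Suc (t - Suc s0) = Suc t - Suc s0" using e(1) by simp
    ultimately show ?thesis using e by auto
  qed
qed simp

lemma inp_impulse_support:
  assumes "\<And>i. poly (A i) 0 = 0" "inp A (impulse s0 s) t i \<noteq> 0"
  shows "s0 < t \<and> (\<exists>e\<in>Ne. (i, e) \<in> E ^^ (t - s0))"
proof -
  obtain j where j: "weight_matrix E (\<lambda>_. 1) i j * out A (impulse s0 s) t j \<noteq> 0"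
    using assms(2) unfolding inp_def by (metis (no_types, lifting) sum.neutral)
  then have ij: "(i, j) \<in> E" by (auto simp: weight_matrix_def split: if_splits)
  obtain e where e: "s0 < t" "e \<in> Ne" "(j, e) \<in> E ^^ (t - Suc s0)"
    using impulse_response_support[of A s0 s t j, OF assms(1)] j by auto
  have "(i, e) \<in> E ^^ Suc (t - Suc s0)" using ij e(3) by (rule relpow_Suc_I2)
  moreover have "Suc (t - Suc s0) = t - s0" using e(1) by simp
  ultimately show ?thesis using e by auto
qed

lemma poly_pos_right:
  fixes p :: "real poly"
  assumes "poly p 0 = 0" "poly (pderiv p) 0 > 0" and "(g \<longlongrightarrow> 0) F"
  shows "eventually (\<lambda>s. g s > 0 \<longrightarrow> poly p (g s) > 0) F"
proof -
  obtain a q where p: "p = pCons a q" by (cases p)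
  then have "a = 0" "poly q 0 > 0" using assms(1,2) by (auto simp: pderiv_pCons)
  have "((\<lambda>s. poly q (g s)) \<longlongrightarrow> poly q 0) F" by (intro tendsto_intros assms(3))
  then have "eventually (\<lambda>s. poly q (g s) > 0) F" using \<open>poly q 0 > 0\<close> by (rule order_tendstoD)
  then show ?thesis by eventually_elim (simp add: p \<open>a = 0\<close>)
qed

context
  fixes A :: "'a \<Rightarrow> real poly"
  assumes A0: "\<And>i. poly (A i) 0 = 0" and A1: "\<And>i. poly (pderiv (A i)) 0 = 1"
begin

lemma impulse_response_tendsto: "((\<lambda>s. out A (impulse s0 s) t i) \<longlongrightarrow> 0) (at_right 0)"
proof (induction t arbitrary: i)
  case (Suc t)
  have "((\<lambda>s. inp A (impulse s0 s) t i) \<longlongrightarrow> (\<Sum>j\<in>N. weight_matrix E (\<lambda>_. 1) i j * 0)) (at_right 0)"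
    unfolding inp_def by (intro tendsto_intros Suc)
  then have "((\<lambda>s. inp A (impulse s0 s) t i) \<longlongrightarrow> 0) (at_right 0)" by simp
  then have "((\<lambda>s. poly (A i) (inp A (impulse s0 s) t i)) \<longlongrightarrow> poly (A i) 0) (at_right 0)"
    by (intro tendsto_intros)
  moreover have "((\<lambda>s. excitation Ne (impulse s0 s) i t) \<longlongrightarrow> (if i \<in> Ne then 1 else 0) * 0) (at_right 0)"
    unfolding excitation_def impulse_def
    by (intro tendsto_mult tendsto_const) (cases "t = s0"; simp add: tendsto_ident_at)
  ultimately have "((\<lambda>s. out A (impulse s0 s) (Suc t) i) \<longlongrightarrow>
      poly (A i) 0 + (if i \<in> Ne then 1 else 0) * 0) (at_right 0)"
    unfolding out_Suc by (rule tendsto_add)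
  then show ?case using A0 by simp
qed simp

lemma inp_impulse_tendsto: "((\<lambda>s. inp A (impulse s0 s) t i) \<longlongrightarrow> 0) (at_right 0)"
proof -
  have "((\<lambda>s. inp A (impulse s0 s) t i) \<longlongrightarrow> (\<Sum>j\<in>N. weight_matrix E (\<lambda>_. 1) i j * 0)) (at_right 0)"
    unfolding inp_def by (intro tendsto_intros impulse_response_tendsto)
  then show ?thesis by simp
qed

lemma excitation_impulse_nonneg: "s \<ge> 0 \<Longrightarrow> excitation Ne (impulse s0 s) i t \<ge> 0"
  by (simp add: excitation_def impulse_def)

lemma eventually_at_right_pos: "eventually (\<lambda>s. s > (0::real)) (at_right 0)"
  by (simp add: eventually_at_right_less)

text \<open>Weights 1 and slopes 1 at 0 rule out cancellation for small positive impulses. This is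
  why the contribution along a single walk survives in \<open>impulse_response_pos\<close>.\<close>

lemma impulse_response_nonneg: "i \<in> N \<Longrightarrow> eventually (\<lambda>s. out A (impulse s0 s) t i \<ge> 0) (at_right 0)"
proof (induction t arbitrary: i)
  case (Suc t)
  have "eventually (\<lambda>s. \<forall>j\<in>N. out A (impulse s0 s) t j \<ge> 0) (at_right 0)"
    using Suc.IH finN by (intro eventually_ball_finite) auto
  moreover have "eventually (\<lambda>s. inp A (impulse s0 s) t i > 0 \<longrightarrow>
      poly (A i) (inp A (impulse s0 s) t i) > 0) (at_right 0)"
    by (rule poly_pos_right[OF A0 _ inp_impulse_tendsto]) (simp add: A1)
  ultimately show ?case using eventually_at_right_pos
  proof eventually_elim
    case (elim s)
    have "inp A (impulse s0 s) t i \<ge> 0"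
      unfolding inp_def using elim(1) by (intro sum_nonneg) (auto simp: weight_matrix_def)
    then have "poly (A i) (inp A (impulse s0 s) t i) \<ge> 0"
      using elim(2) A0 by (cases "inp A (impulse s0 s) t i = 0") auto
    then show ?case using excitation_impulse_nonneg[of s s0 i t] elim(3) by (simp add: out_Suc)
  qed
qed simp

lemma inp_impulse_pos:
  assumes "(i, j) \<in> E" "eventually (\<lambda>s. out A (impulse s0 s) t j > 0) (at_right 0)"
  shows "eventually (\<lambda>s. inp A (impulse s0 s) t i > 0) (at_right 0)"
proof -
  have "eventually (\<lambda>s. \<forall>j\<in>N. out A (impulse s0 s) t j \<ge> 0) (at_right 0)"
    using impulse_response_nonneg finN by (intro eventually_ball_finite) auto
  then show ?thesis using assms(2)
  proof eventually_elim
    case (elim s)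
    show ?case unfolding inp_def
      by (rule sum_pos2[OF finN, of j])
        (use assms(1) EN elim in \<open>auto simp: weight_matrix_def\<close>)
  qed
qed

lemma impulse_response_pos:
  assumes "e \<in> Ne" "(i, e) \<in> E ^^ n" "i \<in> N"
  shows "eventually (\<lambda>s. out A (impulse s0 s) (Suc s0 + n) i > 0) (at_right 0)"
  using assms(2,3)
proof (induction n arbitrary: i)
  case 0
  have "eventually (\<lambda>s. \<forall>j\<in>N. out A (impulse s0 s) s0 j \<ge> 0) (at_right 0)"
    using impulse_response_nonneg finN by (intro eventually_ball_finite) auto
  moreover have "eventually (\<lambda>s. inp A (impulse s0 s) s0 i > 0 \<longrightarrow>
      poly (A i) (inp A (impulse s0 s) s0 i) > 0) (at_right 0)"
    by (rule poly_pos_right[OF A0 _ inp_impulse_tendsto]) (simp add: A1)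
  ultimately show ?case using eventually_at_right_pos
  proof eventually_elim
    case (elim s)
    have "inp A (impulse s0 s) s0 i \<ge> 0"
      unfolding inp_def using elim(1) by (intro sum_nonneg) (auto simp: weight_matrix_def)
    then have "poly (A i) (inp A (impulse s0 s) s0 i) \<ge> 0"
      using elim(2) A0 by (cases "inp A (impulse s0 s) s0 i = 0") auto
    moreover have "excitation Ne (impulse s0 s) i s0 > 0"
      using 0 assms(1) elim(3) by (simp add: excitation_def impulse_def)
    ultimately show ?case by (simp add: out_Suc)
  qed
next
  case (Suc n)
  obtain j where j: "(i, j) \<in> E" "(j, e) \<in> E ^^ n"
    using relpow_Suc_D2[OF Suc.prems(1)] by blast
  then have "eventually (\<lambda>s. inp A (impulse s0 s) (Suc s0 + n) i > 0) (at_right 0)"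
    using Suc.IH[of j] EN by (intro inp_impulse_pos[OF j(1)]) auto
  moreover have "eventually (\<lambda>s. inp A (impulse s0 s) (Suc s0 + n) i > 0 \<longrightarrow>
      poly (A i) (inp A (impulse s0 s) (Suc s0 + n) i) > 0) (at_right 0)"
    by (rule poly_pos_right[OF A0 _ inp_impulse_tendsto]) (simp add: A1)
  ultimately show ?case using eventually_at_right_pos
  proof eventually_elim
    case (elim s)
    then show ?case using excitation_impulse_nonneg[of s s0 i "Suc s0 + n"]
      by (simp add: out_Suc)
  qed
qed

text \<open>An impulse is timed to reach \<open>i\<close> for the first time at \<open>t\<close>.
  The input is 0 before \<open>t\<close>; at \<open>t\<close> it is positive and tends to 0 with the
  size of the impulse, so small sizes avoid \<open>b\<close>.\<close>

lemma inp_nonconstant: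
  assumes "(i, j) \<in> E" "e \<in> Ne" "(j, e) \<in> E ^^ d" "d < t"
  shows "(\<exists>U. inp A U t i \<noteq> b) \<and> (\<forall>\<tau><t. \<exists>U. inp A U t i \<noteq> inp A U \<tau> i)"
proof -
  define P where "P n \<longleftrightarrow> (\<exists>j e. (i, j) \<in> E \<and> e \<in> Ne \<and> (j, e) \<in> E ^^ n)" for n
  define n where "n = (LEAST n. P n)"
  have "P d" using assms by (auto simp: P_def)
  then have "P n" "n \<le> d" unfolding n_def by (auto intro: LeastI Least_le)
  then obtain j' e' where je: "(i, j') \<in> E" "e' \<in> Ne" "(j', e') \<in> E ^^ n"
    by (auto simp: P_def)
  \<comment> \<open>\<open>n\<close> is the least distance from an excited node to a predecessor of
    \<open>i\<close>. By \<open>d < t\<close> the subtraction is not truncated.\<close>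
  define s0 where "s0 = t - Suc n"
  have t: "t = Suc s0 + n" using \<open>n \<le> d\<close> assms(4) by (simp add: s0_def)
  have pos: "eventually (\<lambda>s. inp A (impulse s0 s) t i > 0) (at_right 0)"
    unfolding t by (rule inp_impulse_pos[OF je(1)], rule impulse_response_pos[OF je(2,3)])
      (use je(1) EN in auto)
  have "eventually (\<lambda>s. inp A (impulse s0 s) t i \<noteq> b) (at_right 0)"
  proof (cases "b = 0")
    case True
    then show ?thesis using pos by (auto elim: eventually_mono)
  next
    case False
    then show ?thesis using tendsto_imp_eventually_ne[OF inp_impulse_tendsto[of s0 t i], of b] by auto
  qed
  then have "\<exists>s. inp A (impulse s0 s) t i \<noteq> b"
    using eventually_happens'[of "at_right (0::real)"] by auto
  moreover obtain s where s: "inp A (impulse s0 s) t i > 0"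
    using eventually_happens'[OF _ pos] by auto
  \<comment> \<open>An earlier nonzero input would come along a walk shorter than the minimal
    one.\<close>
  have "inp A (impulse s0 s) \<tau> i = 0" if "\<tau> < t" for \<tau>
  proof (rule ccontr)
    assume "inp A (impulse s0 s) \<tau> i \<noteq> 0"
    then obtain e where e: "s0 < \<tau>" "e \<in> Ne" "(i, e) \<in> E ^^ (\<tau> - s0)"
      using inp_impulse_support[of A s0 s \<tau> i] A0 by auto
    moreover have "\<tau> - s0 = Suc (\<tau> - Suc s0)" using e(1) by simp
    ultimately have "P (\<tau> - Suc s0)"
      unfolding P_def using relpow_Suc_D2[of i e "\<tau> - Suc s0" E] by metis
    then have "n \<le> \<tau> - Suc s0" unfolding n_def by (rule Least_le)
    then show False using that t e(1) by simp
  qed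
  then have "inp A (impulse s0 s) t i \<noteq> inp A (impulse s0 s) \<tau> i" if "\<tau> < t" for \<tau>
    using s that by force
  ultimately show ?thesis by blast
qed

end

end

section \<open>Perturbing single nonlinearities\<close>

context network
begin

definition agree1 :: "real set \<Rightarrow> ('a \<Rightarrow> real poly) \<Rightarrow> ('a \<Rightarrow> real poly) \<Rightarrow> bool" where
  "agree1 B A A' \<longleftrightarrow> (\<forall>i. \<forall>b\<in>B. poly (A' i) b = poly (A i) b \<and>
     poly (pderiv (A' i)) b = poly (pderiv (A i)) b)"

text \<open>Slope 1 at 0 lets small impulses pass every node; perturbations that respect
  \<open>agree1\<close> with 0 in \<open>B\<close> preserve it.\<close>

definition normalized :: "('a \<Rightarrow> real poly) \<Rightarrow> bool" where
  "normalized A \<longleftrightarrow> (\<forall>i. poly (A i) 0 = 0 \<and> poly (pderiv (A i)) 0 = 1)"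

lemma agree1_normalized: "\<lbrakk>agree1 B A A'; 0 \<in> B; normalized A\<rbrakk> \<Longrightarrow> normalized A'"
  by (auto simp: agree1_def normalized_def)

lemma agree1_upd:
  assumes "agree1 B A A'" "\<And>c. c \<in> B \<Longrightarrow> poly R c = 0 \<and> poly (pderiv R) c = 0"
  shows "agree1 B A (A'(j := A' j + R))"
  using assms by (auto simp: agree1_def pderiv_add)

text \<open>For signals whose current input at \<open>j\<close> avoids \<open>B\<close> and the
  earlier inputs at \<open>j\<close>, \<open>double_root_separation\<close> applies to
  \<open>rel\<close>. By \<open>inp_nonconstant\<close> the other signals are zeros of finitely many
  nonzero polynomials, and a polynomial that vanishes off these zeros vanishes identically.\<close>

lemma perturbed_separation:
  assumes "finite B" and "normalized A"
    and j: "(j, l) \<in> E" "e \<in> Ne" "(l, e) \<in> E ^^ d" "d < t"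
    and rel: "\<And>U R. (\<And>c. c \<in> B \<union> (\<lambda>\<tau>. inp A U \<tau> j) ` {..<t} \<Longrightarrow>
        poly R c = 0 \<and> poly (pderiv R) c = 0) \<Longrightarrow>
      poly (pderiv R) (inp A U t j) * dinp A h U t j + \<kappa> * poly R (inp A U t j) = 0"
  shows "\<kappa> = 0" "dinp A h U t j = 0"
proof -
  define F where "F = (\<lambda>b U. inp A U t j - b) ` B \<union> (\<lambda>\<tau> U. inp A U t j - inp A U \<tau> j) ` {..<t}"
  have fin: "finite F" using assms(1) by (simp add: F_def)
  have sub: "F \<subseteq> polyfuns signals"
    unfolding F_def by (auto intro!: polyfuns_diff polyfuns_inp polyfuns.const)
  have A0: "poly (A i) 0 = 0" and A1: "poly (pderiv (A i)) 0 = 1" for i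
    using assms(2) by (auto simp: normalized_def)
  have nz: "\<exists>U. q U \<noteq> 0" if "q \<in> F" for q
    using that inp_nonconstant[OF A0 A1 j] unfolding F_def by auto
  have off: "dinp A h U t j = 0 \<and> \<kappa> = 0" if "\<forall>q\<in>F. q U \<noteq> 0" for U
  proof -
    let ?C = "B \<union> (\<lambda>\<tau>. inp A U \<tau> j) ` {..<t}"
    have "finite ?C" using assms(1) by simp
    moreover have "inp A U t j \<noteq> b" if "b \<in> B" for b
    proof -
      have "(\<lambda>U. inp A U t j - b) \<in> F" using that unfolding F_def by (intro UnI1 imageI)
      from bspec[OF \<open>\<forall>q\<in>F. q U \<noteq> 0\<close> this] show ?thesis by simp
    qed
    moreover have "inp A U t j \<noteq> inp A U \<tau> j" if "\<tau> < t" for \<tau>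
    proof -
      have "(\<lambda>U. inp A U t j - inp A U \<tau> j) \<in> F"
        using that unfolding F_def by (intro UnI2 imageI) simp
      from bspec[OF \<open>\<forall>q\<in>F. q U \<noteq> 0\<close> this] show ?thesis by simp
    qed
    then have "inp A U t j \<notin> (\<lambda>\<tau>. inp A U \<tau> j) ` {..<t}" by blast
    ultimately have "finite ?C" "inp A U t j \<notin> ?C" by blast+
    then show ?thesis using double_root_separation[OF _ _ rel, of ?C U] by blast
  qed
  show "dinp A h U t j = 0"
    by (rule polyfuns_eq_0_off_zeros[OF joined_by_lines_signals fin sub polyfuns_dinp nz])
      (simp_all add: off)
  show "\<kappa> = 0"
    by (rule polyfuns_eq_0_off_zeros[OF joined_by_lines_signals fin sub polyfuns.const nz])
      (simp_all add: off)
qed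

lemma perturb_node:
  assumes "\<And>\<tau>. \<tau> < t \<Longrightarrow> poly R (inp A U \<tau> j) = 0 \<and> poly (pderiv R) (inp A U \<tau> j) = 0"
  shows "inp (A(j := A j + R)) U t i = inp A U t i \<and>
    dinp (A(j := A j + R)) h U t i = dinp A h U t i"
  by (rule first_order_agreement_inp) (use assms in \<open>auto simp: pderiv_add\<close>)

lemma inp_no_pred:
  assumes "\<And>l. (j, l) \<notin> E"
  shows "inp A U t j = 0" "dinp A h U t j = 0"
  using assms by (simp_all add: inp_def dinp_def weight_matrix_def)

context
  fixes K :: nat
  assumes excited: "\<And>i. i \<in> N \<Longrightarrow> \<exists>d\<le>K. \<exists>e\<in>Ne. (i, e) \<in> E ^^ d"
    and measured: "\<And>i. i \<in> N \<Longrightarrow> \<exists>d\<le>K. \<exists>m\<in>Nm. (m, i) \<in> E ^^ d"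
begin

context
  fixes B :: "real set" and A :: "'a \<Rightarrow> real poly" and h :: "'a \<times> 'a \<Rightarrow> real"
  assumes B: "finite B" "0 \<in> B" and A: "normalized A"
begin

text \<open>Perturbing a predecessor \<open>l\<close> of \<open>i\<close> by \<open>R\<close>
  changes \<open>dinp\<close> of \<open>i\<close> at time \<open>t + 1\<close> by
  \<open>R'(x) * dinp + h (i, l) * R(x)\<close>, with \<open>x\<close> and \<open>dinp\<close> taken
  at \<open>l\<close> and time \<open>t\<close>. By \<open>ker\<close> this change is 0, and
  \<open>perturbed_separation\<close> kills both terms. That requires a varying input at
  \<open>l\<close>; a predecessor of \<open>i\<close> without incoming edges is itself excited, and
  a direct test signal handles it.\<close>

lemma kernel_step_back:
  assumes ker: "\<And>A' U. agree1 B A A' \<Longrightarrow> dinp A' h U (Suc t) i = 0"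
    and ij: "(i, j) \<in> E" and t: "K < t"
  shows "h (i, j) = 0 \<and> (\<forall>A' U. agree1 B A A' \<longrightarrow> dinp A' h U t j = 0)"
proof -
  have pred: "h (i, l) = 0 \<and> dinp A' h U t l = 0"
    if il: "(i, l) \<in> E" and lk: "(l, k) \<in> E" and A': "agree1 B A A'" for l k A' U
  proof -
    have N: "i \<in> N" "l \<in> N" "k \<in> N" using il lk EN by auto
    obtain d e where d: "d \<le> K" "e \<in> Ne" "(k, e) \<in> E ^^ d" using excited[OF N(3)] by blast
    have rel: "poly (pderiv R) (inp A' U t l) * dinp A' h U t l + h (i, l) * poly R (inp A' U t l) = 0"
      if R: "\<And>c. c \<in> B \<union> (\<lambda>\<tau>. inp A' U \<tau> l) ` {..<t} \<Longrightarrow> poly R c = 0 \<and> poly (pderiv R) c = 0"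
      for U R
    proof -
      define A'' where "A'' = A'(l := A' l + R)"
      have upd: "A'' l = A' l + R" "p \<noteq> l \<Longrightarrow> A'' p = A' p" for p by (simp_all add: A''_def)
      have same: "inp A'' U t p = inp A' U t p \<and> dinp A'' h U t p = dinp A' h U t p" for p
        unfolding A''_def by (rule perturb_node) (use R in auto)
      let ?f = "\<lambda>A p. weight_matrix E (\<lambda>_. 1) i p * dout A h U (Suc t) p +
        weight_matrix E h i p * out A U (Suc t) p"
      have "?f A'' p - ?f A' p = (if p = l then
          poly (pderiv R) (inp A' U t l) * dinp A' h U t l + h (i, l) * poly R (inp A' U t l) else 0)"
        for p
        using il by (cases "p = l")
          (simp_all add: out_Suc dout_Suc same upd weight_matrix_def pderiv_add algebra_simps)
      then have "dinp A'' h U (Suc t) i - dinp A' h U (Suc t) i = (\<Sum>p\<in>N. if p = l then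
          poly (pderiv R) (inp A' U t l) * dinp A' h U t l + h (i, l) * poly R (inp A' U t l) else 0)"
        unfolding dinp_def[of _ _ _ "Suc t"] sum_subtractf[symmetric] by (intro sum.cong refl)
      also have "\<dots> = poly (pderiv R) (inp A' U t l) * dinp A' h U t l + h (i, l) * poly R (inp A' U t l)"
        using finN N(2) by simp
      moreover have "agree1 B A A''" unfolding A''_def by (rule agree1_upd[OF A']) (use R in auto)
      ultimately show ?thesis using ker[of A'' U] ker[OF A', of U] by simp
    qed
    have "d < t" using d(1) t by simp
    show ?thesis
      using perturbed_separation[OF B(1) agree1_normalized[OF A' B(2) A] lk d(2,3) \<open>d < t\<close> rel]
      by blast
  qed
  show ?thesis
  proof (cases "\<exists>k. (j, k) \<in> E")
    case True
    moreover have "agree1 B A A" by (simp add: agree1_def)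
    ultimately show ?thesis using pred ij by blast
  next
    case False
    have "j \<in> N" using ij EN by auto
    then obtain d e where d: "e \<in> Ne" "(j, e) \<in> E ^^ d" using excited by blast
    \<comment> \<open>\<open>j\<close> has no incoming edge, so the walk from an excited node has
      length 0.\<close>
    have "j \<in> Ne"
    proof (cases d)
      case 0
      then show ?thesis using d by simp
    next
      case (Suc n)
      then show ?thesis using d relpow_Suc_D2 False by metis
    qed
    \<comment> \<open>Only \<open>j\<close> is driven, by the constant 1. Predecessors of
      \<open>i\<close> with incoming edges contribute nothing by \<open>pred\<close>, the others
      have input 0, and so \<open>dinp\<close> of \<open>i\<close> reduces to
      \<open>h (i, j)\<close>.\<close>
    define U where "U = (\<lambda>l (\<tau>::nat). if l = j then 1 else 0 :: real)"
    have AA: "agree1 B A A" by (simp add: agree1_def)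
    have "weight_matrix E (\<lambda>_. 1) i p * dout A h U (Suc t) p +
        weight_matrix E h i p * out A U (Suc t) p = (if p = j then h (i, j) else 0)" for p
    proof (cases "(i, p) \<in> E \<and> (\<exists>k. (p, k) \<in> E)")
      case True
      then have "h (i, p) = 0" "dinp A h U t p = 0" using pred[OF _ _ AA] by blast+
      moreover have "p \<noteq> j" using True False by blast
      ultimately show ?thesis by (simp add: dout_Suc weight_matrix_def)
    next
      case F: False
      show ?thesis
      proof (cases "(i, p) \<in> E")
        case True
        then have "\<And>k. (p, k) \<notin> E" using F by blast
        then have "inp A U t p = 0" "dinp A h U t p = 0" by (rule inp_no_pred)+
        moreover have "poly (A p) 0 = 0" using A by (simp add: normalized_def)
        ultimately show ?thesis using True \<open>j \<in> Ne\<close>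
          by (simp add: dout_Suc out_Suc weight_matrix_def excitation_def U_def)
      next
        case False
        then show ?thesis using ij by (auto simp: weight_matrix_def)
      qed
    qed
    then have "dinp A h U (Suc t) i = h (i, j)"
      unfolding dinp_def using finN \<open>j \<in> N\<close> by simp
    then have "h (i, j) = 0" using ker[OF AA, of U] by simp
    moreover have "dinp A' h U t j = 0" for A' U by (rule inp_no_pred) (use False in blast)
    ultimately show ?thesis by blast
  qed
qed

text \<open>Passing from the measured output at time \<open>2 * K + 3\<close> to \<open>dinp\<close>
  of the measured node costs one time unit, and so does each edge followed backwards. After at most
  \<open>K\<close> edges to \<open>i\<close> and the edge to \<open>j\<close>, time at least
  \<open>K + 1\<close> remains, still more than the distance from the excited nodes.\<close>

lemma kernel_rigid:
  assumes ker: "\<And>A' U m. \<lbrakk>agree1 B A A'; m \<in> Nm\<rbrakk> \<Longrightarrow> dout A' h U (2 * K + 3) m = 0"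
    and ij: "(i, j) \<in> E"
  shows "h (i, j) = 0"
proof -
  have claim: "dinp A' h U (2 * K + 2 - d) p = 0"
    if "m \<in> Nm" "(m, p) \<in> E ^^ d" "d \<le> K" "agree1 B A A'" for d m p A' U
    using that
  proof (induction d arbitrary: p A' U)
    case 0
    let ?t = "2 * K + 2"
    have p: "p = m" using 0 by simp
    show ?case
    proof (cases "\<exists>l. (m, l) \<in> E")
      case True
      then obtain l where ml: "(m, l) \<in> E" by blast
      then have "l \<in> N" using EN by auto
      then obtain d e where d: "d \<le> K" "e \<in> Ne" "(l, e) \<in> E ^^ d" using excited by blast
      have "d < ?t" using d(1) by simp
      \<comment> \<open>The derivative of the output is \<open>dinp\<close> times the slope of the
        nonlinearity of \<open>m\<close>. Varying this slope by \<open>R\<close> frees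
        \<open>dinp\<close> from the factor; this is the separation with \<kappa> = 0.\<close>
      have rel: "poly (pderiv R) (inp A' U ?t m) * dinp A' h U ?t m + 0 * poly R (inp A' U ?t m) = 0"
        if R: "\<And>c. c \<in> B \<union> (\<lambda>\<tau>. inp A' U \<tau> m) ` {..<?t} \<Longrightarrow>
          poly R c = 0 \<and> poly (pderiv R) c = 0" for U R
      proof -
        define A'' where "A'' = A'(m := A' m + R)"
        have upd: "A'' m = A' m + R" by (simp add: A''_def)
        have same: "inp A'' U ?t m = inp A' U ?t m \<and> dinp A'' h U ?t m = dinp A' h U ?t m"
          unfolding A''_def by (rule perturb_node) (use R in auto)
        have "agree1 B A A''" unfolding A''_def by (rule agree1_upd[OF 0(4)]) (use R in auto)
        moreover have "Suc ?t = 2 * K + 3" by simp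
        ultimately have "dout A'' h U (Suc ?t) m = 0" "dout A' h U (Suc ?t) m = 0"
          using ker 0(1,4) by metis+
        then show ?thesis unfolding dout_Suc upd using same by (auto simp: pderiv_add)
      qed
      show ?thesis
        using perturbed_separation(2)[OF B(1) agree1_normalized[OF 0(4) B(2) A] ml d(2,3) \<open>d < ?t\<close> rel]
        unfolding p by simp
    next
      case False
      then show ?thesis unfolding p by (intro inp_no_pred) blast
    qed
  next
    case (Suc d)
    obtain k where k: "(m, k) \<in> E ^^ d" "(k, p) \<in> E"
      using relpow_Suc_E[OF Suc.prems(2)] by blast
    have "2 * K + 2 - d = Suc (2 * K + 2 - Suc d)" using Suc.prems(3) by simp
    then have "dinp A' h U (Suc (2 * K + 2 - Suc d)) k = 0" if "agree1 B A A'" for A' U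
      using Suc.IH[OF Suc.prems(1) k(1) _ that] Suc.prems(3) by simp
    then show ?case
      using kernel_step_back[OF _ k(2), of "2 * K + 2 - Suc d"] Suc.prems(3,4) by simp
  qed
  have "i \<in> N" using ij EN by auto
  then obtain d m where d: "d \<le> K" "m \<in> Nm" "(m, i) \<in> E ^^ d" using measured by blast
  have "2 * K + 2 - d = Suc (2 * K + 1 - d)" using d(1) by simp
  then have "dinp A' h U (Suc (2 * K + 1 - d)) i = 0" if "agree1 B A A'" for A' U
    using claim[OF d(2,3,1) that] by simp
  then show ?thesis using kernel_step_back[OF _ ij, of "2 * K + 1 - d"] d(1) by simp
qed

end

text \<open>The columns \<open>S\<close> of the Jacobian are independent already on the finitely many tests \<open>Q\<close>.\<close>

definition independent_columns ::
    "('a \<Rightarrow> real poly) \<Rightarrow> ('a \<times> ('a \<Rightarrow> nat \<Rightarrow> real)) set \<Rightarrow> ('a \<times> 'a) set \<Rightarrow> bool" where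
  "independent_columns A Q S \<longleftrightarrow> (\<forall>h. (\<forall>e. e \<notin> S \<longrightarrow> h e = 0) \<longrightarrow>
     (\<forall>(m, U) \<in> Q. dout A h U (2 * K + 3) m = 0) \<longrightarrow> (\<forall>e. h e = 0))"

text \<open>Choose \<open>A\<close>, \<open>Q\<close>, \<open>S\<close> with \<open>S\<close> as large as possible. If an edge \<open>e\<close> were missing from \<open>S\<close>,
  the dependency \<open>h\<close> of column \<open>e\<close> on \<open>S\<close> would be determined by \<open>Q\<close> alone, hence be the same for
  all nonlinearities that agree with \<open>A\<close> to first order at the finitely many arguments occurring
  in the tests. This contradicts rigidity.\<close>

lemma ex_trivial_kernel:
  shows "\<exists>A. (\<forall>i. coeff (A i) 0 = 0) \<and>
    (\<forall>h. (\<forall>m\<in>Nm. \<forall>U. dout A h U (2 * K + 3) m = 0) \<longrightarrow> (\<forall>e\<in>E. h e = 0))"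
proof -
  let ?T = "2 * K + 3"
  have finE: "finite E" using finN EN finite_subset by blast
  define P where "P n \<longleftrightarrow> (\<exists>A Q S. normalized A \<and> finite Q \<and> Q \<subseteq> Nm \<times> UNIV \<and> S \<subseteq> E \<and>
    independent_columns A Q S \<and> card S = n)" for n
  have "P 0"
    unfolding P_def
    by (intro exI[of _ "\<lambda>_. [:0, 1:]"] exI[of _ "{}"])
      (auto simp: normalized_def independent_columns_def pderiv_pCons)
  moreover have "\<forall>n. P n \<longrightarrow> n \<le> card E" unfolding P_def using card_mono[OF finE] by blast
  ultimately obtain n where n: "P n" "\<And>k. P k \<Longrightarrow> k \<le> n"
    using Greatest_le_nat[of P _ "card E"] GreatestI_nat[of P 0 "card E"] by blast
  obtain A Q S where AQS: "normalized A" "finite Q" "Q \<subseteq> Nm \<times> UNIV" "S \<subseteq> E"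
    "independent_columns A Q S" "card S = n"
    using n(1) unfolding P_def by blast
  have "S = E"
  proof (rule ccontr)
    assume "S \<noteq> E"
    then obtain e where e: "e \<in> E" "e \<notin> S" using AQS(4) by blast
    \<comment> \<open>By maximality of \<open>n\<close> the columns \<open>insert e S\<close> are
      dependent on every finite set of tests. Since \<open>S\<close> is independent on
      \<open>Q\<close>, the coefficient of \<open>e\<close> is nonzero and can be scaled to
      1.\<close>
    have ext: "\<exists>g. (\<forall>d. d \<notin> insert e S \<longrightarrow> g d = 0) \<and> g e = 1 \<and>
        (\<forall>(m, U) \<in> Q'. dout A' g U ?T m = 0)"
      if A': "normalized A'" "independent_columns A' Q S" and Q': "finite Q'" "Q' \<subseteq> Nm \<times> UNIV" "Q \<subseteq> Q'"
      for A' Q'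
    proof -
      have "\<not> independent_columns A' Q' (insert e S)"
      proof
        assume "independent_columns A' Q' (insert e S)"
        moreover have "card (insert e S) = Suc n"
          using e(2) AQS(4,6) finE finite_subset by (metis card_insert_disjoint)
        ultimately have "P (Suc n)" unfolding P_def using A'(1) Q' e(1) AQS(4)
          by (metis insert_subset)
        then show False using n(2) by fastforce
      qed
      then obtain g where g: "\<And>d. d \<notin> insert e S \<Longrightarrow> g d = 0"
        "\<forall>(m, U) \<in> Q'. dout A' g U ?T m = 0" "\<exists>d. g d \<noteq> 0"
        unfolding independent_columns_def by blast
      have ge: "g e \<noteq> 0"
      proof
        assume "g e = 0"
        then have "\<forall>d. d \<notin> S \<longrightarrow> g d = 0" using g(1) \<open>g e = 0\<close> by (metis insertE)
        moreover have "\<forall>(m, U) \<in> Q. dout A' g U ?T m = 0" using g(2) Q'(3) by blast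
        ultimately have "\<forall>d. g d = 0" using A'(2) unfolding independent_columns_def by blast
        then show False using g(3) by simp
      qed
      have "dout A' (\<lambda>d. g d / g e) U t m = dout A' g U t m / g e" for U t m
        using dout_linear[of A' "1 / g e" g 0 "\<lambda>_. 0"] by simp
      then show ?thesis using g ge by (intro exI[of _ "\<lambda>d. g d / g e"]) auto
    qed
    obtain h where h: "\<And>d. d \<notin> insert e S \<Longrightarrow> h d = 0" "h e = 1"
      "\<forall>(m, U) \<in> Q. dout A h U ?T m = 0"
      using ext[OF AQS(1,5,2,3)] by blast
    \<comment> \<open>All inputs met in the tests \<open>Q\<close> before time \<open>?T\<close>, so
      that agreement to first order on \<open>B\<close> preserves the derivatives on
      \<open>Q\<close>. The point 0 preserves normalization.\<close>
    define B where "B = insert 0 ((\<lambda>((m, U), \<tau>, i). inp A U \<tau> i) ` (Q \<times> {..<?T} \<times> N))"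
    have B: "finite B" "0 \<in> B" using AQS(2) finN by (simp_all add: B_def)
    have "dout A' h U ?T m = 0" if A': "agree1 B A A'" and m: "m \<in> Nm" for A' U m
    proof -
      have same: "dout A' g V ?T p = dout A g V ?T p" if "(p, V) \<in> Q" for g V p
      proof -
        have "p \<in> N" using that AQS(3) NmN by auto
        moreover have "inp A V \<tau> i \<in> B" if "\<tau> < ?T" "i \<in> N" for \<tau> i
          unfolding B_def using that \<open>(p, V) \<in> Q\<close>
          by (intro insertI2 image_eqI[of _ _ "((p, V), \<tau>, i)"]) auto
        ultimately show ?thesis
          using first_order_agreement[of ?T A' A V ?T p g] A' by (auto simp: agree1_def)
      qed
      have norm: "normalized A'" by (rule agree1_normalized[OF A' B(2) AQS(1)])
      have ind: "independent_columns A' Q S"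
        unfolding independent_columns_def
      proof (intro allI impI)
        fix g d
        assume g: "\<forall>d. d \<notin> S \<longrightarrow> g d = 0" "\<forall>(m, U) \<in> Q. dout A' g U ?T m = 0"
        have "\<forall>(m, U) \<in> Q. dout A g U ?T m = 0"
        proof clarify
          fix p V assume "(p, V) \<in> Q"
          then show "dout A g V ?T p = 0" using bspec[OF g(2)] same[of p V g] by auto
        qed
        then show "g d = 0" using AQS(5) g(1) unfolding independent_columns_def by blast
      qed
      \<comment> \<open>The arbitrary test \<open>(m, U)\<close> is adjoined to \<open>Q\<close>.
        The resulting dependency \<open>g\<close> equals \<open>h\<close>, because
        \<open>g - h\<close> is supported on \<open>S\<close> and lies in the kernel on
        \<open>Q\<close>. Hence \<open>h\<close> passes the new test.\<close>
      obtain g where g: "\<And>d. d \<notin> insert e S \<Longrightarrow> g d = 0" "g e = 1"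
        "\<forall>(m, U) \<in> insert (m, U) Q. dout A' g U ?T m = 0"
        using ext[OF norm ind, of "insert (m, U) Q"] AQS(2,3) m by auto
      define r where "r d = 1 * g d + - 1 * h d" for d
      have "r d = 0" if "d \<notin> S" for d
        using that g(1)[of d] g(2) h(1)[of d] h(2) by (cases "d = e") (auto simp: r_def)
      moreover have "dout A' r V ?T p = 0" if "(p, V) \<in> Q" for p V
      proof -
        have "dout A' g V ?T p = 0" "dout A h V ?T p = 0"
          using bspec[OF g(3), of "(p, V)"] bspec[OF h(3) that] that by simp_all
        then show ?thesis
          using dout_linear[of A' 1 g "- 1" h V ?T p] same[OF that, of h] unfolding r_def by simp
      qed
      ultimately have "\<forall>d. r d = 0" using ind unfolding independent_columns_def by blast
      then have "g = h" by (auto simp: r_def)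
      then show ?thesis using g(3) by auto
    qed
    then have "h e = 0" using kernel_rigid[OF B AQS(1)] e(1) by (cases e) blast
    then show False using h(2) by simp
  qed
  show ?thesis
  proof (intro exI[of _ A] conjI allI impI)
    show "coeff (A i) 0 = 0" for i
      using AQS(1) by (simp add: normalized_def poly_0_coeff_0)
    show "\<forall>e\<in>E. h e = 0" if "\<forall>m\<in>Nm. \<forall>U. dout A h U ?T m = 0" for h
    proof -
      define g where "g e = (if e \<in> E then h e else 0)" for e
      have "dout A g U ?T m = dout A h U ?T m" for U m
        using dout_cong[of g h A U ?T] by (simp add: g_def)
      then have "\<forall>(m, U) \<in> Q. dout A g U ?T m = 0" using that AQS(3) by auto
      moreover have "\<forall>e. e \<notin> S \<longrightarrow> g e = 0" using \<open>S = E\<close> by (simp add: g_def)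
      ultimately have "\<forall>e. g e = 0" using AQS(5) unfolding independent_columns_def by blast
      then show ?thesis by (metis g_def)
    qed
  qed
qed

end

end

section \<open>Taylor expansion of the outputs\<close>

lemma poly_bigo_1:
  fixes g :: "'b \<Rightarrow> real"
  assumes "g \<in> O[F](\<lambda>_. 1)"
  shows "(\<lambda>x. poly p (g x)) \<in> O[F](\<lambda>_. 1)"
proof (induction p)
  case (pCons a p)
  have "(\<lambda>x. g x * poly p (g x)) \<in> O[F](\<lambda>_. 1 * 1)"
    by (rule landau_o.big.mult[OF assms pCons(2)])
  then show ?case by (simp add: sum_in_bigo)
qed simp

lemma poly_diff_bigo:
  fixes g h :: "'b \<Rightarrow> real"
  assumes g: "g \<in> O[F](\<lambda>_. 1)" and h: "h \<in> O[F](\<lambda>_. 1)"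
  shows "(\<lambda>x. poly p (g x) - poly p (h x)) \<in> O[F](\<lambda>x. g x - h x)"
proof (induction p)
  case (pCons a p)
  have "(\<lambda>x. g x * (poly p (g x) - poly p (h x))) \<in> O[F](\<lambda>x. 1 * (g x - h x))"
    by (rule landau_o.big.mult[OF g pCons(2)])
  moreover have "(\<lambda>x. (g x - h x) * poly p (h x)) \<in> O[F](\<lambda>x. (g x - h x) * 1)"
    by (rule landau_o.big.mult[OF landau_o.big_refl poly_bigo_1[OF h]])
  ultimately have "(\<lambda>x. g x * (poly p (g x) - poly p (h x)) + (g x - h x) * poly p (h x))
      \<in> O[F](\<lambda>x. g x - h x)"
    by (simp add: sum_in_bigo)
  then show ?case by (simp add: algebra_simps)
qed simp

lemma tendsto_bigo_1:
  fixes g :: "'b \<Rightarrow> real"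
  assumes "(g \<longlongrightarrow> c) F"
  shows "g \<in> O[F](\<lambda>_. 1)"
proof (rule bigoI[of _ "\<bar>c\<bar> + 1"])
  have "((\<lambda>x. \<bar>g x\<bar>) \<longlongrightarrow> \<bar>c\<bar>) F" by (intro tendsto_intros assms)
  then have "eventually (\<lambda>x. \<bar>g x\<bar> < \<bar>c\<bar> + 1) F" by (rule order_tendstoD) simp
  then show "eventually (\<lambda>x. norm (g x) \<le> (\<bar>c\<bar> + 1) * norm (1 :: real)) F"
    by eventually_elim simp
qed

text \<open>The series of the difference is divisible by \<open>fps_X ^ Suc M\<close>, with quotient
  bounded near 0. The filter \<open>nhds 0\<close> includes 0 itself, so the estimate can be
  composed with functions that take the value 0.\<close>

lemma has_fps_expansion_jet:
  fixes f :: "real \<Rightarrow> real"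
  assumes "f has_fps_expansion F" "\<And>k. k \<le> M \<Longrightarrow> coeff p k = fps_nth F k"
  shows "(\<lambda>z. f z - poly p z) \<in> O[nhds 0](\<lambda>z. z ^ Suc M)"
proof -
  define G where "G = F - fps_of_poly p"
  define H where "H = fps_shift (Suc M) G"
  have p: "poly p has_fps_expansion fps_of_poly p" by (simp add: has_fps_expansion_def)
  have G: "(\<lambda>z. f z - poly p z) has_fps_expansion G"
    unfolding G_def by (rule has_fps_expansion_diff[OF assms(1) p])
  have GH: "G = H * fps_X ^ Suc M"
    unfolding H_def
    by (rule fps_ext) (use assms(2) in \<open>auto simp: fps_X_power_mult_right_nth G_def simp del: power_Suc\<close>)
  have r: "fps_conv_radius H > 0" using G by (simp add: H_def has_fps_expansion_def)
  have "eventually (\<lambda>z. z \<in> eball 0 (fps_conv_radius H)) (nhds 0)"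
    using r by (intro eventually_nhds_in_open) (auto simp: zero_ereal_def)
  moreover have "eventually (\<lambda>z. eval_fps G z = f z - poly p z) (nhds 0)"
    using G by (simp add: has_fps_expansion_def)
  ultimately have ev: "eventually (\<lambda>z. eval_fps H z * z ^ Suc M = f z - poly p z) (nhds 0)"
  proof eventually_elim
    case (elim z)
    have "eval_fps G z = eval_fps H z * eval_fps (fps_X ^ Suc M) z"
      unfolding GH using elim(1) by (intro eval_fps_mult) (auto simp del: power_Suc)
    then show ?case using elim(2) by (simp del: power_Suc)
  qed
  have "isCont (eval_fps H) 0"
    using r by (intro continuous_eval_fps) (auto simp: zero_ereal_def)
  then have "(eval_fps H \<longlongrightarrow> eval_fps H 0) (nhds 0)"
    by (simp add: isCont_def tendsto_nhds_iff)
  then have "(\<lambda>z. eval_fps H z * z ^ Suc M) \<in> O[nhds 0](\<lambda>z. 1 * z ^ Suc M)"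
    by (intro landau_o.big.mult tendsto_bigo_1) auto
  then show ?thesis using landau_o.big.in_cong[OF ev] by simp
qed

text \<open>If the order \<open>n\<close> of \<open>p\<close> at 0 were at most \<open>M\<close>,
  the cofactor of \<open>z ^ n\<close> would be nonzero at 0 and yet bounded by a multiple of a
  positive power of \<open>\<bar>z\<bar>\<close>.\<close>

lemma bigo_power_nhds_0_coeff:
  fixes p :: "real poly"
  assumes "poly p \<in> O[nhds 0](\<lambda>z. z ^ Suc M)" "k \<le> M"
  shows "coeff p k = 0"
proof (rule ccontr)
  assume k: "coeff p k \<noteq> 0"
  then have "p \<noteq> 0" by auto
  obtain q where q: "p = [:- 0, 1:] ^ order 0 p * q" "\<not> [:- 0, 1:] dvd q"
    using order_decomp[OF \<open>p \<noteq> 0\<close>, of 0] by blast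
  define n where "n = order 0 p"
  have pq: "p = monom 1 n * q"
    using q(1) by (simp add: n_def monom_altdef)
  have q0: "poly q 0 \<noteq> 0" using q(2) by (simp add: poly_eq_0_iff_dvd)
  have "n \<le> k" using k unfolding pq by (auto simp: coeff_monom_mult split: if_splits)
  obtain c where c: "c > 0" "eventually (\<lambda>z. norm (poly p z) \<le> c * norm (z ^ Suc M)) (nhds 0)"
    using landau_o.bigE[OF assms(1)] by blast
  have "eventually (\<lambda>z. norm (poly p z) \<le> c * norm (z ^ Suc M)) (at 0)"
    using c(2) unfolding eventually_at_filter by (auto elim: eventually_mono)
  moreover have "eventually (\<lambda>z. z \<noteq> (0::real)) (at 0)"
    by (simp add: eventually_at_filter)
  ultimately have le: "eventually (\<lambda>z. \<bar>poly q z\<bar> \<le> c * \<bar>z\<bar> ^ (Suc M - n)) (at 0)"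
  proof eventually_elim
    case (elim z)
    have "\<bar>z\<bar> ^ n * \<bar>poly q z\<bar> \<le> c * \<bar>z\<bar> ^ Suc M"
      using elim(1) unfolding pq by (simp add: poly_monom abs_mult power_abs del: power_Suc)
    also have "\<bar>z\<bar> ^ Suc M = \<bar>z\<bar> ^ n * \<bar>z\<bar> ^ (Suc M - n)"
      using \<open>n \<le> k\<close> assms(2) by (subst power_add[symmetric]) auto
    finally have "\<bar>z\<bar> ^ n * \<bar>poly q z\<bar> \<le> \<bar>z\<bar> ^ n * (c * \<bar>z\<bar> ^ (Suc M - n))"
      by (simp add: mult_ac)
    then show ?case using elim(2) by simp
  qed
  have "((\<lambda>z. \<bar>poly q z\<bar>) \<longlongrightarrow> \<bar>poly q 0\<bar>) (at 0)" by (intro tendsto_intros)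
  moreover have "((\<lambda>z. c * \<bar>z\<bar> ^ (Suc M - n)) \<longlongrightarrow> c * \<bar>0::real\<bar> ^ (Suc M - n)) (at 0)"
    by (intro tendsto_intros)
  ultimately have "\<bar>poly q 0\<bar> \<le> c * \<bar>0::real\<bar> ^ (Suc M - n)"
    using le by (intro tendsto_le[of "at 0"]) auto
  moreover have "(0::real) ^ (Suc M - n) = 0"
    using \<open>n \<le> k\<close> assms(2) by (intro zero_power) simp
  ultimately show False using q0 by simp
qed

section \<open>Outputs under scaled signals\<close>

text \<open>The variable is the common factor \<open>z\<close> of the signals \<open>z U\<close>;
  the excitation is therefore linear in it.\<close>

primrec output_poly :: "'a set \<Rightarrow> ('a \<times> 'a) set \<Rightarrow> 'a set \<Rightarrow> ('a \<Rightarrow> real poly) \<Rightarrow>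
    ('a \<times> 'a \<Rightarrow> real) \<Rightarrow> ('a \<Rightarrow> nat \<Rightarrow> real) \<Rightarrow> nat \<Rightarrow> 'a \<Rightarrow> real poly" where
  "output_poly N E Ne A w U 0 = (\<lambda>i. 0)"
| "output_poly N E Ne A w U (Suc t) =
     (\<lambda>i. pcompose (A i) (\<Sum>j\<in>N. smult (weight_matrix E w i j) (output_poly N E Ne A w U t j))
           + [:0, excitation Ne U i t:])"

lemma poly_output_poly:
  "poly (output_poly N E Ne A w U t i) z =
     node_output N E Ne (\<lambda>i. poly (A i)) w (\<lambda>i s. z * U i s) t i"
  by (induction t arbitrary: i) (simp_all add: poly_pcompose poly_sum excitation_def)

lemma output_poly_at_0:
  assumes "\<And>i. i \<in> N \<Longrightarrow> poly (A i) 0 = 0" "i \<in> N"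
  shows "poly (output_poly N E Ne A w U t i) 0 = 0"
  using assms(2) by (induction t arbitrary: i) (simp_all add: poly_pcompose poly_sum assms(1))

text \<open>The bound is uniform in weights and signals, so finitely many coefficients capture the
  output. The base \<Delta> + 1 leaves room for the linear excitation term.\<close>

lemma degree_output_poly:
  assumes "finite N" "\<And>i. i \<in> N \<Longrightarrow> degree (A i) \<le> \<Delta>" "i \<in> N"
  shows "degree (output_poly N E Ne A w U t i) \<le> (\<Delta> + 1) ^ t"
  using assms(3)
proof (induction t arbitrary: i)
  case (Suc t)
  have "degree (\<Sum>j\<in>N. smult (weight_matrix E w i j) (output_poly N E Ne A w U t j)) \<le> (\<Delta> + 1) ^ t"
    using Suc.IH by (intro degree_sum_le assms(1)) (meson degree_smult_le order_trans)
  then have "degree (pcompose (A i)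
      (\<Sum>j\<in>N. smult (weight_matrix E w i j) (output_poly N E Ne A w U t j))) \<le> \<Delta> * (\<Delta> + 1) ^ t"
    using assms(2)[OF Suc.prems] by (simp add: degree_pcompose mult_le_mono)
  also have "\<dots> \<le> (\<Delta> + 1) ^ Suc t" by simp
  finally have 1: "degree (pcompose (A i)
      (\<Sum>j\<in>N. smult (weight_matrix E w i j) (output_poly N E Ne A w U t j))) \<le> (\<Delta> + 1) ^ Suc t" .
  have "degree [:0, excitation Ne U i t:] \<le> 1" by simp
  also have "1 \<le> (\<Delta> + 1) ^ Suc t" by (rule one_le_power) simp
  finally show ?case using 1 by (simp only: output_poly.simps degree_add_le)
qed simp

lemma bigo_cmult_left:
  fixes g h :: "'b \<Rightarrow> real"
  assumes "g \<in> O[F](h)"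
  shows "(\<lambda>x. c * g x) \<in> O[F](h)"
  using assms by (cases "c = 0") simp_all

lemma poly_zero_bigo:
  fixes p :: "real poly"
  assumes "poly p 0 = 0"
  shows "poly p \<in> O[nhds 0](\<lambda>z. z)"
proof -
  obtain a q where p: "p = pCons a q" by (cases p)
  have "(poly q \<longlongrightarrow> poly q 0) (nhds 0)" by (intro tendsto_intros filterlim_ident)
  then have "(\<lambda>z. z * poly q z) \<in> O[nhds 0](\<lambda>z. z * 1)"
    by (intro landau_o.big.mult landau_o.big_refl tendsto_bigo_1)
  moreover have "poly p = (\<lambda>z. z * poly q z)" using assms by (auto simp: p)
  ultimately show ?thesis by simp
qed

lemma bigo_id_tendsto_0:
  fixes g :: "real \<Rightarrow> real"
  assumes "g \<in> O[nhds 0](\<lambda>z. z)"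
  shows "(g \<longlongrightarrow> 0) (nhds 0)"
proof -
  obtain c where c: "eventually (\<lambda>z. norm (g z) \<le> c * norm z) (nhds 0)"
    using landau_o.bigE[OF assms] by blast
  have "isCont (\<lambda>z::real. c * norm z) 0" by (intro continuous_intros)
  then have "((\<lambda>z::real. c * norm z) \<longlongrightarrow> 0) (nhds 0)" by (simp add: isCont_def tendsto_nhds_iff)
  then show ?thesis by (rule Lim_null_comparison[OF c])
qed

text \<open>The error splits into \<open>f i (X z) - poly (A i) (X z)\<close>, small because
  \<open>X\<close> is of order \<open>z\<close>, and
  \<open>poly (A i) (X z) - poly (A i) (poly P z)\<close>, small because \<open>X - P\<close> is so
  by induction. Maclaurin coefficients beyond \<open>M\<close> thus leave the output unaffected up
  to order \<open>M\<close>.\<close>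

lemma node_output_jet:
  assumes "\<And>i. i \<in> N \<Longrightarrow> (\<lambda>x. f i x - poly (A i) x) \<in> O[nhds 0](\<lambda>x. x ^ Suc M)"
    and "\<And>i. i \<in> N \<Longrightarrow> poly (A i) 0 = 0" and "i \<in> N"
  shows "(\<lambda>z. node_output N E Ne f w (\<lambda>i s. z * U i s) t i - poly (output_poly N E Ne A w U t i) z)
    \<in> O[nhds 0](\<lambda>z. z ^ Suc M)"
  using assms(3)
proof (induction t arbitrary: i)
  case (Suc t)
  let ?y = "\<lambda>z. node_output N E Ne f w (\<lambda>i s. z * U i s) t" and ?p = "output_poly N E Ne A w U t"
  define X where "X z = (\<Sum>j\<in>N. weight_matrix E w i j * ?y z j)" for z
  define P where "P = (\<Sum>j\<in>N. smult (weight_matrix E w i j) (?p j))"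
  have "(\<lambda>z. \<Sum>j\<in>N. weight_matrix E w i j * (?y z j - poly (?p j) z)) \<in> O[nhds 0](\<lambda>z. z ^ Suc M)"
    by (intro big_sum_in_bigo bigo_cmult_left Suc.IH)
  moreover have "(\<lambda>z. \<Sum>j\<in>N. weight_matrix E w i j * (?y z j - poly (?p j) z)) = (\<lambda>z. X z - poly P z)"
    by (simp add: X_def P_def poly_sum sum_subtractf algebra_simps)
  ultimately have D: "(\<lambda>z. X z - poly P z) \<in> O[nhds 0](\<lambda>z. z ^ Suc M)" by simp
  have "poly P 0 = 0" by (simp add: P_def poly_sum output_poly_at_0 assms(2))
  then have P: "poly P \<in> O[nhds 0](\<lambda>z. z)" by (rule poly_zero_bigo)
  have "(\<lambda>z. z ^ Suc M) \<in> O[nhds 0](\<lambda>z::real. z)"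
    using poly_zero_bigo[of "monom 1 (Suc M)"] by (simp add: poly_monom[abs_def])
  with D have "(\<lambda>z. X z - poly P z) \<in> O[nhds 0](\<lambda>z. z)" by (rule landau_o.big_trans)
  from sum_in_bigo(1)[OF this P] have X: "X \<in> O[nhds 0](\<lambda>z. z)" by simp
  have "(\<lambda>z. f i (X z) - poly (A i) (X z)) \<in> O[nhds 0](\<lambda>z. X z ^ Suc M)"
    using landau_o.big.compose[OF assms(1)[OF Suc.prems] bigo_id_tendsto_0[OF X]] .
  also have "(\<lambda>z. X z ^ Suc M) \<in> O[nhds 0](\<lambda>z. z ^ Suc M)"
    by (rule landau_o.big_power[OF X])
  finally have 1: "(\<lambda>z. f i (X z) - poly (A i) (X z)) \<in> O[nhds 0](\<lambda>z. z ^ Suc M)" .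
  have "(\<lambda>z. poly (A i) (X z) - poly (A i) (poly P z)) \<in> O[nhds 0](\<lambda>z. X z - poly P z)"
    by (intro poly_diff_bigo tendsto_bigo_1[OF bigo_id_tendsto_0] X P)
  also note D
  finally have 2: "(\<lambda>z. poly (A i) (X z) - poly (A i) (poly P z)) \<in> O[nhds 0](\<lambda>z. z ^ Suc M)" .
  note sum_in_bigo(1)[OF 1 2]
  moreover have "node_output N E Ne f w (\<lambda>i s. z * U i s) (Suc t) i -
      poly (output_poly N E Ne A w U (Suc t) i) z = f i (X z) - poly (A i) (poly P z)" for z
    by (simp add: X_def P_def poly_pcompose excitation_def)
  ultimately show ?case by (simp del: node_output.simps output_poly.simps)
qed simp

section \<open>Polynomial dependence on Maclaurin coefficients and weights\<close>

lemma pcompose_monom: "pcompose (monom c k) q = smult c (q ^ k)"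
  for q :: "'b :: comm_semiring_1 poly"
  by (induction k) (simp_all add: monom_0 monom_Suc pcompose_pCons)

lemma polyfuns_coeff_power:
  assumes "\<And>n. (\<lambda>x. coeff (X x) n) \<in> polyfuns G"
  shows "(\<lambda>x. coeff (X x ^ k) n) \<in> polyfuns G"
proof (induction k arbitrary: n)
  case 0
  then show ?case by (simp add: polyfuns.const)
next
  case (Suc k)
  then show ?case unfolding power_Suc coeff_mult
    by (intro polyfuns_sum polyfuns.mult assms)
qed

text \<open>Powers start at 1 because members of \<open>F_Z\<close> vanish at 0.\<close>

definition poly_of_coeffs :: "nat \<Rightarrow> ('a \<times> nat \<Rightarrow> real) \<Rightarrow> 'a \<Rightarrow> real poly" where
  "poly_of_coeffs M a i = (\<Sum>k = 1..M. monom (a (i, k)) k)"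

lemma coeff_poly_of_coeffs: "coeff (poly_of_coeffs M a i) k = (if k \<in> {1..M} then a (i, k) else 0)"
  unfolding poly_of_coeffs_def by (simp add: coeff_sum)

lemma polyfuns_output_coeff:
  assumes "i \<in> N"
  shows "(\<lambda>p. coeff (output_poly N E Ne (poly_of_coeffs M (fst p)) (snd p) U t i) n)
    \<in> polyfuns (coords2 (N \<times> {1..M}) E)"
  using assms
proof (induction t arbitrary: i n)
  case 0
  then show ?case by (simp add: polyfuns.const)
next
  case (Suc t)
  let ?G = "coords2 (N \<times> {1..M}) E"
  define X where "X p = (\<Sum>j\<in>N. smult (weight_matrix E (snd p) i j)
    (output_poly N E Ne (poly_of_coeffs M (fst p)) (snd p) U t j))" for p
  have w: "(\<lambda>p. weight_matrix E (snd p) i j) \<in> polyfuns ?G" for j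
    by (cases "(i, j) \<in> E") (auto simp: weight_matrix_def intro: polyfuns.const polyfuns.gen)
  have X: "(\<lambda>p. coeff (X p) n) \<in> polyfuns ?G" for n
    unfolding X_def coeff_sum coeff_smult by (intro polyfuns_sum polyfuns.mult w Suc.IH)
  have a: "(\<lambda>p. fst p (i, k)) \<in> polyfuns ?G" if "k \<in> {1..M}" for k
    using that Suc.prems by (intro polyfuns.gen UnI1 image_eqI[of _ _ "(i, k)"]) auto
  have eq: "coeff (output_poly N E Ne (poly_of_coeffs M (fst p)) (snd p) U (Suc t) i) n =
      (\<Sum>k = 1..M. fst p (i, k) * coeff (X p ^ k) n) + coeff [:0, excitation Ne U i t:] n" for p
    by (simp add: X_def poly_of_coeffs_def pcompose_sum pcompose_monom coeff_sum)
  show ?case unfolding eq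
    by (intro polyfuns.add polyfuns_sum polyfuns.mult polyfuns.const polyfuns_coeff_power X a)
qed

lemma poly_1_eq_sum_coeff:
  fixes p :: "'b :: comm_semiring_1 poly"
  assumes "degree p \<le> M"
  shows "poly p 1 = (\<Sum>k\<le>M. coeff p k)"
proof -
  have "poly p 1 = (\<Sum>k\<le>degree p. coeff p k)" by (simp add: poly_altdef)
  also have "\<dots> = (\<Sum>k\<le>M. coeff p k)"
    using assms by (intro sum.mono_neutral_left) (auto simp: coeff_eq_0)
  finally show ?thesis .
qed

lemma uniform_bound:
  fixes P :: "'b \<Rightarrow> nat \<Rightarrow> bool"
  assumes "finite S" "\<And>i. i \<in> S \<Longrightarrow> \<exists>d. P i d"
  obtains K where "\<And>i. i \<in> S \<Longrightarrow> \<exists>d\<le>K. P i d"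
proof -
  obtain d where d: "\<And>i. i \<in> S \<Longrightarrow> P i (d i)" using assms(2) by metis
  have "d i \<le> Max (d ` S)" if "i \<in> S" for i using that assms(1) by simp
  then show ?thesis using that d by blast
qed

text \<open>The tests \<Phi> are the coefficients in \<open>z\<close> of the measured outputs under
  signals \<open>z U\<close>. At the base point their derivatives add up, at \<open>z = 1\<close>,
  to \<open>dout\<close>, so \<open>ker\<close> yields the hypothesis of
  \<open>generic_local_injectivity\<close>. For analytic \<open>f\<close>, equal input-output
  functions force equal coefficients up to order \<open>M\<close>.\<close>

lemma (in network) generically_identifiable_if_trivial_kernel:
  assumes T: "T > 0" and A0: "\<And>i. coeff (A i) 0 = 0"
    and ker: "\<And>h e. \<lbrakk>\<And>m U. m \<in> Nm \<Longrightarrow> dout A h U T m = 0; e \<in> E\<rbrakk> \<Longrightarrow> h e = 0"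
  shows "almost_all_collections N (\<lambda>f. generically_locally_identifiable N E Ne Nm f)"
proof -
  define \<Delta> where "\<Delta> = Max (insert 0 ((\<lambda>i. degree (A i)) ` N))"
  have \<Delta>: "degree (A i) \<le> \<Delta>" if "i \<in> N" for i using that finN by (simp add: \<Delta>_def)
  \<comment> \<open>The first summand lets \<open>a0\<close> encode the base nonlinearities
    completely; the second one covers the degrees of their outputs at time \<open>T\<close>.\<close>
  define M where "M = \<Delta> + (\<Delta> + 1) ^ T"
  have M: "M > 0" "\<Delta> \<le> M" "(\<Delta> + 1) ^ T \<le> M" by (auto simp: M_def)
  have finE: "finite E" using finN EN finite_subset by blast
  let ?B = "N \<times> {1..M}"
  let ?c = "\<lambda>m U k p. coeff (output_poly N E Ne (poly_of_coeffs M (fst p)) (snd p) U T m) k"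
  define \<Phi> where "\<Phi> = {?c m U k | m U k. m \<in> Nm \<and> k \<le> M}"
  define a0 where "a0 = (\<lambda>(i, k). coeff (A i) k)"
  have a0: "poly_of_coeffs M a0 i = A i" if "i \<in> N" for i
  proof (rule poly_eqI)
    fix k
    have "coeff (A i) k = 0" if "k > M" using \<Delta>[OF \<open>i \<in> N\<close>] M(2) that by (intro coeff_eq_0) simp
    then show "coeff (poly_of_coeffs M a0 i) k = coeff (A i) k"
      using A0[of i] by (cases "k = 0") (auto simp: coeff_poly_of_coeffs a0_def not_le)
  qed
  have cong: "output_poly N E Ne (poly_of_coeffs M a0) w U t i = output_poly N E Ne A w U t i"
    if "i \<in> N" for w U t i
    using that by (induction t arbitrary: i) (simp_all add: a0)
  have "\<exists>Z \<in> null_sets (lebesgue_coords ?B). \<forall>a. a \<in> ?B \<rightarrow>\<^sub>E UNIV \<longrightarrow> a \<notin> Z \<longrightarrow>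
    (AE w in lebesgue_coords E. \<exists>\<epsilon>>0. \<forall>w' \<in> E \<rightarrow>\<^sub>E UNIV. L2_set (\<lambda>e. w e - w' e) E < \<epsilon> \<longrightarrow>
      (\<forall>q\<in>\<Phi>. q (a, w) = q (a, w')) \<longrightarrow> w = w')"
  proof (rule generic_local_injectivity[where ?a0.0 = a0 and ?w0.0 = "\<lambda>_. 1"])
    show "finite ?B" "finite E" using finN finE by simp_all
    show "\<Phi> \<subseteq> polyfuns (coords2 ?B E)"
    proof
      fix q assume "q \<in> \<Phi>"
      then obtain m U k where q: "q = ?c m U k" "m \<in> Nm" by (auto simp: \<Phi>_def)
      then have "m \<in> N" using NmN by blast
      then show "q \<in> polyfuns (coords2 ?B E)" unfolding q(1) by (rule polyfuns_output_coeff)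
    qed
    show "h e = 0" if der: "\<And>q. q \<in> \<Phi> \<Longrightarrow>
        ((\<lambda>s. q (a0, \<lambda>e. 1 + s * h e)) has_real_derivative 0) (at 0)" and "e \<in> E" for h e
    proof (rule ker[OF _ \<open>e \<in> E\<close>])
      fix m U assume m: "m \<in> Nm"
      then have "m \<in> N" using NmN by blast
      let ?w = "\<lambda>s e. 1 + s * h e"
      define C where "C s k = coeff (output_poly N E Ne A (?w s) U T m) k" for s k
      have C: "((\<lambda>s. C s k) has_real_derivative 0) (at 0)"
        if "k \<le> M" for k
      proof -
        have "?c m U k \<in> \<Phi>" unfolding \<Phi>_def using m that by blast
        from der[OF this] show ?thesis by (simp add: cong[OF \<open>m \<in> N\<close>] C_def)
      qed
      have "((\<lambda>s. \<Sum>k\<le>M. C s k) has_real_derivative (\<Sum>k\<le>M. 0)) (at 0)"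
        using DERIV_sum[of "{..M}" C "\<lambda>_. 0"] C by simp
      moreover have "(\<Sum>k\<le>M. C s k) =
          node_output N E Ne (\<lambda>i. poly (A i)) (?w s) U T m" for s
      proof -
        have "degree (output_poly N E Ne A (?w s) U T m) \<le> M"
          by (rule order_trans[OF degree_output_poly[OF finN \<Delta> \<open>m \<in> N\<close>] M(3)])
        then have "poly (output_poly N E Ne A (?w s) U T m) 1 =
            (\<Sum>k\<le>M. coeff (output_poly N E Ne A (?w s) U T m) k)"
          by (rule poly_1_eq_sum_coeff)
        then show ?thesis by (simp add: poly_output_poly C_def)
      qed
      ultimately have "((\<lambda>s. node_output N E Ne (\<lambda>i. poly (A i)) (?w s) U T m)
          has_real_derivative 0) (at 0)"
        by simp
      then show "dout A h U T m = 0" by (rule DERIV_unique[OF dout_is_derivative])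
    qed
  qed
  then obtain Z where Z: "Z \<in> null_sets (lebesgue_coords ?B)"
    and gen: "\<And>a. \<lbrakk>a \<in> ?B \<rightarrow>\<^sub>E UNIV; a \<notin> Z\<rbrakk> \<Longrightarrow>
      AE w in lebesgue_coords E. \<exists>\<epsilon>>0. \<forall>w' \<in> E \<rightarrow>\<^sub>E UNIV. L2_set (\<lambda>e. w e - w' e) E < \<epsilon> \<longrightarrow>
      (\<forall>q\<in>\<Phi>. q (a, w) = q (a, w')) \<longrightarrow> w = w'"
    by blast
  have "generically_locally_identifiable N E Ne Nm f"
    if f: "\<forall>i\<in>N. f i \<in> F_Z" and nZ: "(\<lambda>(i, k) \<in> ?B. maclaurin_coeff (f i) k) \<notin> Z" for f
  proof -
    define a where "a = (\<lambda>(i, k) \<in> ?B. maclaurin_coeff (f i) k)"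
    have a: "a \<in> ?B \<rightarrow>\<^sub>E UNIV" "a \<notin> Z" using nZ by (auto simp: a_def)
    have jet: "(\<lambda>x. f i x - poly (poly_of_coeffs M a i) x) \<in> O[nhds 0](\<lambda>x. x ^ Suc M)"
      if i: "i \<in> N" for i
    proof -
      have "\<exists>F. (\<lambda>h. f i (0 + h)) has_fps_expansion F"
        using f i unfolding F_Z_def real_analytic_def by blast
      then obtain F where F: "f i has_fps_expansion F" by auto
      have "f i 0 = 0" using f i by (auto simp: F_Z_def)
      then have "fps_nth F 0 = 0" using maclaurin_coeff_eq[OF F, of 0] by (simp add: maclaurin_coeff_def)
      then show ?thesis
        by (intro has_fps_expansion_jet[OF F])
          (use i in \<open>auto simp: coeff_poly_of_coeffs a_def maclaurin_coeff_eq[OF F] not_less_eq_eq\<close>)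
    qed
    have zero: "poly (poly_of_coeffs M a i) 0 = 0" for i
      by (simp add: poly_0_coeff_0 coeff_poly_of_coeffs)
    have same: "q (a, w) = q (a, w')"
      if eq: "\<forall>i\<in>Nm. past_input_fun N E Ne f w T i = past_input_fun N E Ne f w' T i" and q: "q \<in> \<Phi>"
      for w w' q
    proof -
      obtain m U k where q: "q = ?c m U k" "m \<in> Nm" "k \<le> M" using q by (auto simp: \<Phi>_def)
      then have "m \<in> N" using NmN by blast
      let ?p = "\<lambda>w. output_poly N E Ne (poly_of_coeffs M a) w U T m"
      let ?y = "\<lambda>w z. node_output N E Ne f w (\<lambda>i s. z * U i s) T m"
      have y: "?y w z = ?y w' z" for z
        using fun_cong[OF bspec[OF eq q(2)], of "\<lambda>i s. z * U i s"] by (simp add: past_input_fun_def)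
      \<comment> \<open>The outputs of \<open>f\<close> agree for every scaling \<open>z\<close>, so
        the two output polynomials differ only beyond order \<open>M\<close>.\<close>
      have "(\<lambda>z. (?y w' z - poly (?p w') z) - (?y w z - poly (?p w) z)) \<in> O[nhds 0](\<lambda>z. z ^ Suc M)"
        by (rule sum_in_bigo(2); rule node_output_jet) (use jet zero \<open>m \<in> N\<close> in auto)
      then have "poly (?p w - ?p w') \<in> O[nhds 0](\<lambda>z. z ^ Suc M)"
        by (simp add: y poly_diff[abs_def] del: power_Suc)
      then have "coeff (?p w - ?p w') k = 0" using q(3) by (rule bigo_power_nhds_0_coeff)
      then show ?thesis by (simp add: q(1))
    qed
    show ?thesis
      unfolding generically_locally_identifiable_def using gen[OF a]
    proof eventually_elim
      case (elim w)
      then obtain \<epsilon> where "\<epsilon> > 0" and \<epsilon>: "\<And>w'. \<lbrakk>w' \<in> E \<rightarrow>\<^sub>E UNIV; L2_set (\<lambda>e. w e - w' e) E < \<epsilon>;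
          \<forall>q\<in>\<Phi>. q (a, w) = q (a, w')\<rbrakk> \<Longrightarrow> w = w'"
        by blast
      then show ?case
        unfolding locally_identifiable_def using T same
        by (intro exI[of _ T] exI[of _ \<epsilon>] conjI) blast+
    qed
  qed
  then show ?thesis unfolding almost_all_collections_def using M(1) Z by blast
qed

lemma excitation_measurement_sufficient:
  assumes "finite N" "E \<subseteq> N \<times> N" "Ne \<subseteq> N" "Nm \<subseteq> N"
    and "\<forall>C \<in> source_components N E. \<exists>i\<in>C. i \<in> Ne"
    and "\<forall>C \<in> sink_components N E. \<exists>i\<in>C. i \<in> Nm"
  shows "almost_all_collections N (\<lambda>f. generically_locally_identifiable N E Ne Nm f)"
proof -
  interpret network N E Ne Nm by unfold_locales (use assms in auto)
  have "\<exists>d. \<exists>e\<in>Ne. (i, e) \<in> E ^^ d" if "i \<in> N" for i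
    using excited_ancestor[OF assms(1,2,5) that] rtrancl_imp_relpow by blast
  then obtain K1 where K1: "\<And>i. i \<in> N \<Longrightarrow> \<exists>d\<le>K1. \<exists>e\<in>Ne. (i, e) \<in> E ^^ d"
    using uniform_bound[OF assms(1), of "\<lambda>i d. \<exists>e\<in>Ne. (i, e) \<in> E ^^ d"] by blast
  have "\<exists>d. \<exists>m\<in>Nm. (m, i) \<in> E ^^ d" if "i \<in> N" for i
    using measured_descendant[OF assms(1,2,6) that] rtrancl_imp_relpow by blast
  then obtain K2 where K2: "\<And>i. i \<in> N \<Longrightarrow> \<exists>d\<le>K2. \<exists>m\<in>Nm. (m, i) \<in> E ^^ d"
    using uniform_bound[OF assms(1), of "\<lambda>i d. \<exists>m\<in>Nm. (m, i) \<in> E ^^ d"] by blast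
  define K where "K = max K1 K2"
  have "\<exists>d\<le>K. \<exists>e\<in>Ne. (i, e) \<in> E ^^ d" "\<exists>d\<le>K. \<exists>m\<in>Nm. (m, i) \<in> E ^^ d" if "i \<in> N" for i
    using K1[OF that] K2[OF that] unfolding K_def by (meson max.coboundedI1 max.coboundedI2)+
  from ex_trivial_kernel[OF this] obtain A where A: "\<And>i. coeff (A i) 0 = 0"
    and ker: "\<And>h. \<forall>m\<in>Nm. \<forall>U. dout A h U (2 * K + 3) m = 0 \<Longrightarrow> \<forall>e\<in>E. h e = 0"
    by blast
  show ?thesis
    by (rule generically_identifiable_if_trivial_kernel[of "2 * K + 3" A])
      (use A ker in auto)
qed

text \<open>A node without any edge, not even a self-loop, is by itself a source and a sink
  component, yet no weight is attached to it, so identifiability says nothing about its excitation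
  or measurement. The hypothesis \<open>isolated\<close> settles these nodes.\<close>

theorem theorem2:
  fixes N :: "'a set" and E :: "('a \<times> 'a) set" and Ne Nm :: "'a set"
  assumes "finite N" and "E \<subseteq> N \<times> N" and "Ne \<subseteq> N" and "Nm \<subseteq> N"
    and isolated: "\<And>i. i \<in> N \<Longrightarrow> \<forall>j. (i, j) \<notin> E \<and> (j, i) \<notin> E \<Longrightarrow> i \<in> Ne \<and> i \<in> Nm"
  shows "almost_all_collections N (\<lambda>f. generically_locally_identifiable N E Ne Nm f) \<longleftrightarrow>
    (\<forall>C \<in> source_components N E. \<exists>i\<in>C. i \<in> Ne) \<and>
    (\<forall>C \<in> sink_components N E. \<exists>i\<in>C. i \<in> Nm)"
  using excitation_measurement_necessary[OF assms(1,2) isolated]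
    excitation_measurement_sufficient[OF assms(1-4)] by blast

end
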